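(* Let $M\subset\mathbb{C}$ be a domain, $h$ a harmonic function on $M$, $\omega$ a finite signed Borel measure on $\mathbb{C}$ with compact support, and $z_0\in M$. For any $\epsilon>0$ and $\eta>0$ there exist $\delta>0$ with $\overline{Q_{\delta(1+\eta)}(z_0)}\subset M$, a constant $k\in\mathbb{R}$ and a finite signed Borel measure $\tilde\omega$ such that: (i) $\tilde\omega=\omega$ on $Q_\delta(z_0)$; (ii) $\tilde\omega=0$ outside $Q_{\delta(1+\eta)}(z_0)$; (iii) $|\tilde\omega|\big(Q_{\delta(1+\eta)}(z_0)\setminus\{z_0\}\big)<\epsilon$; (iv) on $Q_\delta(z_0)$ (wherever both sides are defined) $p(\omega,h)=p(\tilde\omega)+k$.
   Context: For a finite positive compactly supported measure $\mu$, $p(z;\mu)=\frac1{2\pi}\iint\ln|z-\zeta|\,d\mu(\zeta)$. For a finite signed compactly supported measure $\omega$ with Jordan decomposition $\omega=\omega^+-\omega^-$ and harmonic $h$, $p(\omega,h)=p(\omega^+)-p(\omega^-)+h$ and $p(\omega)=p(\omega,0)$; these are defined wherever $p(\omega^+)$ and $p(\omega^-)$ are not both $-\infty$. $|\omega|=\omega^++\omega^-$ is the total variation measure; $Q_r(z_0)$ is the open disc of center $z_0$, radius $r$. *)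

theory Defs
  imports "HOL-Analysis.Analysis"
begin

definition fin_borel :: "complex measure \<Rightarrow> bool" where
  "fin_borel \<mu> \<longleftrightarrow> sets \<mu> = sets borel \<and> emeasure \<mu> (space \<mu>) < \<infinity>"

text \<open>A finite signed Borel measure is represented by its Jordan decomposition
  \<open>(\<omega>p, \<omega>n)\<close>: two finite positive Borel measures which are mutually singular.\<close>
definition jordan_pair :: "complex measure \<Rightarrow> complex measure \<Rightarrow> bool" where
  "jordan_pair \<omega>p \<omega>n \<longleftrightarrow> fin_borel \<omega>p \<and> fin_borel \<omega>n \<and>
     (\<exists>P\<in>sets borel. emeasure \<omega>p (- P) = 0 \<and> emeasure \<omega>n P = 0)"

definition compact_supp :: "complex measure \<Rightarrow> complex measure \<Rightarrow> bool" where
  "compact_supp \<omega>p \<omega>n \<longleftrightarrow>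
     (\<exists>K. compact K \<and> emeasure \<omega>p (- K) = 0 \<and> emeasure \<omega>n (- K) = 0)"

text \<open>Logarithmic potential \<open>p(z;\<mu>) = (1/2\<pi>) \<integral> ln|z-\<zeta>| d\<mu>(\<zeta>)\<close>, with values in
  the extended reals (split into positive and negative parts; the log at
  \<open>\<zeta> = z\<close> is \<open>-\<infinity>\<close>).\<close>
definition pot :: "complex measure \<Rightarrow> complex \<Rightarrow> ereal" where
  "pot \<mu> z = ereal (1 / (2 * pi)) *
     (enn2ereal (\<integral>\<^sup>+ \<zeta>. ennreal (max 0 (ln (cmod (z - \<zeta>)))) \<partial>\<mu>)
      - enn2ereal (\<integral>\<^sup>+ \<zeta>. (if \<zeta> = z then \<infinity> else ennreal (max 0 (- ln (cmod (z - \<zeta>))))) \<partial>\<mu>))"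

definition pot_defined :: "complex measure \<Rightarrow> complex measure \<Rightarrow> complex \<Rightarrow> bool" where
  "pot_defined \<omega>p \<omega>n z \<longleftrightarrow> \<not> (pot \<omega>p z = -\<infinity> \<and> pot \<omega>n z = -\<infinity>)"

definition pot_h :: "complex measure \<Rightarrow> complex measure \<Rightarrow> (complex \<Rightarrow> real) \<Rightarrow> complex \<Rightarrow> ereal" where
  "pot_h \<omega>p \<omega>n h z = pot \<omega>p z - pot \<omega>n z + ereal (h z)"

definition harmonic_on :: "(complex \<Rightarrow> real) \<Rightarrow> complex set \<Rightarrow> bool" where
  "harmonic_on h M \<longleftrightarrow> open M \<and>
     (\<exists>h' h''. (\<forall>z\<in>M. (h has_derivative h' z) (at z)) \<and>
        (\<forall>z\<in>M. \<forall>v. ((\<lambda>w. h' w v) has_derivative h'' z v) (at z)) \<and>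
        (\<forall>v u. continuous_on M (\<lambda>z. h'' z v u)) \<and>
        (\<forall>z\<in>M. h'' z 1 1 + h'' z \<i> \<i> = 0))"

end

theory Submission
  imports Defs "HOL-Complex_Analysis.Cauchy_Integral_Formula"
begin

text \<open>
  Let \<open>\<rho> = \<delta> * (1 + \<eta>)\<close>. On \<open>ball z0 \<rho>\<close> the sum of \<open>h\<close> and the potential of the part of
  \<open>\<omega>\<close> outside this disc is a harmonic function \<open>v\<close>. For a radius \<open>r < \<rho>\<close> the function \<open>v\<close>
  agrees inside the circle of radius \<open>r\<close>, up to the constant \<open>v z0\<close>, with the logarithmic
  potential of the measure on that circle with density \<open>-2\<close> times the normal derivative of
  \<open>v\<close>. Hence \<open>\<omega>\<close> restricted to \<open>ball z0 \<rho>\<close> plus this circle measure has the required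
  potential. If \<open>\<delta> < r < \<delta> * (1 + \<eta> / 2)\<close>, the mass of the circle measure is bounded by
  a constant depending on \<open>\<eta>\<close> times the mass of \<open>|\<omega>|\<close> on a small punctured disc around
  \<open>z0\<close>, plus a term that is \<open>O(r)\<close>.
\<close>

section \<open>Harmonic functions as real parts\<close>

text \<open>The factor \<open>-2\<close> comes from reflection. Take \<open>v - v z0\<close> inside
  the circle and its mirror image under \<open>w \<mapsto> z0 + r^2 / cnj (w - z0)\<close> outside.
  This function is continuous across the circle and tends to 0 at infinity, while its radial
  derivative jumps by -2 times that of \<open>v\<close>. Since the logarithm divided by
  \<open>2 * pi\<close> is the fundamental solution of the Laplacian, the jump is the density of the
  measure that generates it. The obstacle is mass of \<open>\<omega>\<close> lying just outside the
  disc: on a circle close to the boundary its effect on the normal derivative has no bound. Keeping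
  \<open>r\<close> below \<open>\<delta> * (1 + \<eta> / 2)\<close> leaves a gap of at least
  \<open>\<delta> * \<eta> / 2\<close>, and the scale-invariant kernel is then at most
  \<open>(2 + \<eta>) / \<eta>\<close>, whatever \<open>\<delta>\<close> is. The mass multiplied by
  this factor lies in a punctured disc and vanishes with its radius; an atom at \<open>z0\<close> is
  kept and never swept.\<close>

text \<open>Two one-variable mean value theorems: along \<open>u\<close> for the increment of
  \<open>h\<close> in direction \<open>v\<close>, and along \<open>v\<close> for the resulting
  increment of \<open>h'\<close>.\<close>

lemma second_difference_mean_value:
  fixes h :: "'a::real_normed_vector \<Rightarrow> real"
  assumes d1: "\<And>w. w \<in> ball z R \<Longrightarrow> (h has_derivative h' w) (at w)"
    and d2: "\<And>w. w \<in> ball z R \<Longrightarrow> ((\<lambda>w. h' w u) has_derivative h'' w) (at w)"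
    and s: "0 < s" "s * (norm u + norm v) < R"
  shows "\<exists>x y. 0 < x \<and> x < s \<and> 0 < y \<and> y < s \<and>
    h (z + s *\<^sub>R u + s *\<^sub>R v) - h (z + s *\<^sub>R u) - h (z + s *\<^sub>R v) + h z
      = s * s * h'' (z + x *\<^sub>R u + y *\<^sub>R v) v"
proof -
  have in_ball: "z + x *\<^sub>R u + y *\<^sub>R v \<in> ball z R" if "0 \<le> x" "x \<le> s" "0 \<le> y" "y \<le> s" for x y
  proof -
    have "norm (x *\<^sub>R u + y *\<^sub>R v) \<le> x * norm u + y * norm v"
      using norm_triangle_ineq[of "x *\<^sub>R u" "y *\<^sub>R v"] that by simp
    also have "\<dots> \<le> s * norm u + s * norm v"
      using that by (intro add_mono mult_right_mono) auto
    finally show ?thesis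
      using s by (simp add: dist_norm algebra_simps norm_minus_commute)
  qed
  have D: "((\<lambda>x. h (z + x *\<^sub>R u + y *\<^sub>R v)) has_real_derivative h' (z + x *\<^sub>R u + y *\<^sub>R v) u) (at x)"
    if "0 \<le> x" "x \<le> s" "0 \<le> y" "y \<le> s" for x y
  proof -
    have "((\<lambda>x. z + x *\<^sub>R u + y *\<^sub>R v) has_vector_derivative u) (at x)"
      by (auto intro!: derivative_eq_intros)
    from vector_derivative_diff_chain_within[OF this has_derivative_at_withinI[OF d1[OF in_ball[OF that]]]]
    show ?thesis by (simp add: o_def has_real_derivative_iff_has_vector_derivative)
  qed
  have "((\<lambda>x. h (z + x *\<^sub>R u + s *\<^sub>R v) - h (z + x *\<^sub>R u)) has_real_derivative
      h' (z + x *\<^sub>R u + s *\<^sub>R v) u - h' (z + x *\<^sub>R u) u) (at x)" if "0 \<le> x" "x \<le> s" for x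
    using D[of x s] D[of x 0] that s by (auto intro: DERIV_diff)
  from MVT2[OF s(1) this] obtain x where x: "0 < x" "x < s"
    "h (z + s *\<^sub>R u + s *\<^sub>R v) - h (z + s *\<^sub>R u) - (h (z + s *\<^sub>R v) - h z)
      = s * (h' (z + x *\<^sub>R u + s *\<^sub>R v) u - h' (z + x *\<^sub>R u) u)"
    by auto
  have "((\<lambda>y. h' (z + x *\<^sub>R u + y *\<^sub>R v) u) has_real_derivative h'' (z + x *\<^sub>R u + y *\<^sub>R v) v) (at y)"
    if "0 \<le> y" "y \<le> s" for y
  proof -
    have "((\<lambda>y. z + x *\<^sub>R u + y *\<^sub>R v) has_vector_derivative v) (at y)"
      by (auto intro!: derivative_eq_intros)
    from vector_derivative_diff_chain_within[OF this has_derivative_at_withinI[OF d2[OF in_ball]]] x that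
    show ?thesis by (simp add: o_def has_real_derivative_iff_has_vector_derivative)
  qed
  from MVT2[OF s(1) this] obtain y where y: "0 < y" "y < s"
    "h' (z + x *\<^sub>R u + s *\<^sub>R v) u - h' (z + x *\<^sub>R u) u = s * h'' (z + x *\<^sub>R u + y *\<^sub>R v) v"
    by auto
  show ?thesis
    using x y by (intro exI[of _ x] exI[of _ y]) auto
qed

text \<open>The second difference along \<open>s *\<^sub>R u\<close> and
  \<open>s *\<^sub>R v\<close> does not depend on the order of the two directions, and each order
  writes it as \<open>s * s\<close> times a mixed derivative at a point close to \<open>z\<close>.
  By continuity, for small \<open>s\<close> both values differ from those at \<open>z\<close> by
  less than half the supposed gap.\<close>

lemma second_derivative_symmetric:
  fixes h :: "'a::real_normed_vector \<Rightarrow> real"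
  assumes "open S" "z \<in> S"
    and d1: "\<And>w. w \<in> S \<Longrightarrow> (h has_derivative h' w) (at w)"
    and d2: "\<And>w x. w \<in> S \<Longrightarrow> ((\<lambda>w. h' w x) has_derivative h'' w x) (at w)"
    and cont: "\<And>x y. continuous_on S (\<lambda>w. h'' w x y)"
  shows "h'' z u v = h'' z v u"
proof (rule ccontr)
  assume ne: "h'' z u v \<noteq> h'' z v u"
  define e where "e = \<bar>h'' z u v - h'' z v u\<bar> / 2"
  have e: "e > 0" using ne by (simp add: e_def)
  obtain R where R: "R > 0" "ball z R \<subseteq> S"
    using assms(1,2) open_contains_ball by blast
  have near: "\<exists>d>0. \<forall>w\<in>S. dist w z < d \<longrightarrow> \<bar>h'' w x y - h'' z x y\<bar> < e" for x y
    using cont[of x y] \<open>z \<in> S\<close> e by (auto simp: continuous_on_iff dist_real_def)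
  obtain d where d: "d > 0" "\<And>w. w \<in> S \<Longrightarrow> dist w z < d \<Longrightarrow> \<bar>h'' w u v - h'' z u v\<bar> < e"
    using near[of u v] by metis
  obtain d' where d': "d' > 0" "\<And>w. w \<in> S \<Longrightarrow> dist w z < d' \<Longrightarrow> \<bar>h'' w v u - h'' z v u\<bar> < e"
    using near[of v u] by metis
  define m where "m = min R (min d d')"
  define s where "s = m / (norm u + norm v + 1)"
  have "m > 0" using R d d' by (simp add: m_def)
  moreover have pos: "norm u + norm v + 1 > 0"
    by (simp add: add_nonneg_pos)
  ultimately have "s > 0" by (simp add: s_def)
  have "s * (norm u + norm v + 1) = m"
    using pos by (simp add: s_def)
  then have sm: "s * (norm u + norm v) < m"
    using \<open>s > 0\<close> by (simp add: algebra_simps)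
  have close: "dist (z + x *\<^sub>R a + y *\<^sub>R b) z < m"
    if "0 < x" "x < s" "0 < y" "y < s" "s * (norm a + norm b) < m" for x y a b
  proof -
    have "dist (z + x *\<^sub>R a + y *\<^sub>R b) z = norm (x *\<^sub>R a + y *\<^sub>R b)"
      by (simp add: dist_norm)
    also have "\<dots> \<le> x * norm a + y * norm b"
      using norm_triangle_ineq[of "x *\<^sub>R a" "y *\<^sub>R b"] that by simp
    also have "\<dots> \<le> s * norm a + s * norm b"
      using that by (intro add_mono mult_right_mono) auto
    finally show ?thesis
      using that by (simp add: algebra_simps)
  qed
  have D1: "\<And>w. w \<in> ball z R \<Longrightarrow> (h has_derivative h' w) (at w)"
    using d1 R by blast
  have D2: "\<And>w x. w \<in> ball z R \<Longrightarrow> ((\<lambda>w. h' w x) has_derivative h'' w x) (at w)"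
    using d2 R by blast
  have sR: "s * (norm u + norm v) < R" "s * (norm v + norm u) < R"
    using sm by (auto simp: m_def add.commute)
  obtain x y where xy: "0 < x" "x < s" "0 < y" "y < s"
    "h (z + s *\<^sub>R u + s *\<^sub>R v) - h (z + s *\<^sub>R u) - h (z + s *\<^sub>R v) + h z
      = s * s * h'' (z + x *\<^sub>R u + y *\<^sub>R v) u v"
    using second_difference_mean_value[OF D1 D2 \<open>s > 0\<close> sR(1)] by blast
  obtain x' y' where xy': "0 < x'" "x' < s" "0 < y'" "y' < s"
    "h (z + s *\<^sub>R v + s *\<^sub>R u) - h (z + s *\<^sub>R v) - h (z + s *\<^sub>R u) + h z
      = s * s * h'' (z + x' *\<^sub>R v + y' *\<^sub>R u) v u"
    using second_difference_mean_value[OF D1 D2 \<open>s > 0\<close> sR(2)] by blast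
  have "h (z + s *\<^sub>R v + s *\<^sub>R u) = h (z + s *\<^sub>R u + s *\<^sub>R v)"
    by (simp add: add_ac)
  then have "s * s * h'' (z + x *\<^sub>R u + y *\<^sub>R v) u v = s * s * h'' (z + x' *\<^sub>R v + y' *\<^sub>R u) v u"
    using xy(5) xy'(5) by linarith
  then have eq: "h'' (z + x *\<^sub>R u + y *\<^sub>R v) u v = h'' (z + x' *\<^sub>R v + y' *\<^sub>R u) v u"
    using \<open>s > 0\<close> by simp
  have c: "dist (z + x *\<^sub>R u + y *\<^sub>R v) z < m" "dist (z + x' *\<^sub>R v + y' *\<^sub>R u) z < m"
    using close[of x y u v] close[of x' y' v u] xy xy' sm by (auto simp: add.commute)
  have m: "w \<in> S" "dist w z < d" "dist w z < d'" if "dist w z < m" for w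
    using that R by (auto simp: m_def dist_commute)
  have "\<bar>h'' (z + x *\<^sub>R u + y *\<^sub>R v) u v - h'' z u v\<bar> < e"
    "\<bar>h'' (z + x' *\<^sub>R v + y' *\<^sub>R u) v u - h'' z v u\<bar> < e"
    by (rule d(2)[OF m(1,2)[OF c(1)]] d'(2)[OF m(1,3)[OF c(2)]])+
  then have "\<bar>h'' z u v - h'' z v u\<bar> < e + e"
    unfolding eq by linarith
  moreover have "e + e = \<bar>h'' z u v - h'' z v u\<bar>"
    by (simp add: e_def)
  ultimately show False
    by linarith
qed

text \<open>If \<open>h\<close> is the real part of \<open>F\<close>, the derivative of
  \<open>F\<close> has to be \<open>\<phi>\<close>, the x-derivative of \<open>h\<close> minus \<i>
  times its y-derivative. The Cauchy-Riemann equations for \<open>\<phi>\<close> are the symmetry of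
  the mixed derivatives and the Laplace equation. A disc is convex, so \<open>\<phi>\<close> has a
  primitive there, whose real part differs from \<open>h\<close> by a constant.\<close>

lemma harmonic_on_ball_eq_Re:
  assumes "harmonic_on h M" "ball z0 R \<subseteq> M"
  obtains F F' where "\<And>w. w \<in> ball z0 R \<Longrightarrow> (F has_field_derivative F' w) (at w)"
    "\<And>w. w \<in> ball z0 R \<Longrightarrow> h w = Re (F w)"
proof -
  obtain h' h'' where "open M" and
    "\<forall>z\<in>M. (h has_derivative h' z) (at z)"
    "\<forall>z\<in>M. \<forall>v. ((\<lambda>w. h' w v) has_derivative h'' z v) (at z)"
    "\<forall>v u. continuous_on M (\<lambda>z. h'' z v u)"
    "\<forall>z\<in>M. h'' z 1 1 + h'' z \<i> \<i> = 0"
    using assms(1) unfolding harmonic_on_def by (elim conjE exE) (rule that; assumption)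
  then have d1: "\<And>z. z \<in> M \<Longrightarrow> (h has_derivative h' z) (at z)"
    and d2: "\<And>z v. z \<in> M \<Longrightarrow> ((\<lambda>w. h' w v) has_derivative h'' z v) (at z)"
    and cont: "\<And>v u. continuous_on M (\<lambda>z. h'' z v u)"
    and lap: "\<And>z. z \<in> M \<Longrightarrow> h'' z 1 1 + h'' z \<i> \<i> = 0"
    by simp_all
  define \<phi> where "\<phi> z = of_real (h' z 1) - \<i> * of_real (h' z \<i>)" for z
  have linear_split: "l v = Re v * l 1 + Im v * l \<i>" if "bounded_linear l" for l :: "complex \<Rightarrow> real" and v
  proof -
    have "v = Re v *\<^sub>R 1 + Im v *\<^sub>R \<i>"
      by (simp add: complex_eq_iff)
    then have "l v = l (Re v *\<^sub>R 1 + Im v *\<^sub>R \<i>)"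
      by (rule arg_cong)
    also have "\<dots> = Re v * l 1 + Im v * l \<i>"
      by (simp only: linear_simps[OF that] real_scaleR_def)
    finally show ?thesis .
  qed
  have "(\<phi> has_field_derivative (of_real (h'' z 1 1) - \<i> * of_real (h'' z \<i> 1))) (at z)" if "z \<in> M" for z
  proof -
    have "(\<phi> has_derivative (\<lambda>v. of_real (h'' z 1 v) - \<i> * of_real (h'' z \<i> v))) (at z)"
      unfolding \<phi>_def by (intro derivative_intros has_derivative_of_real d2 that)
    moreover have "(\<lambda>v. of_real (h'' z 1 v) - \<i> * of_real (h'' z \<i> v)) =
        (*) (of_real (h'' z 1 1) - \<i> * of_real (h'' z \<i> 1))"
    proof
      fix v
      have "h'' z 1 \<i> = h'' z \<i> 1"
        by (rule second_derivative_symmetric[OF \<open>open M\<close> that d1 d2 cont])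
      moreover have "h'' z \<i> \<i> = - h'' z 1 1"
        using lap[OF that] by linarith
      moreover have "h'' z 1 v = Re v * h'' z 1 1 + Im v * h'' z 1 \<i>"
        "h'' z \<i> v = Re v * h'' z \<i> 1 + Im v * h'' z \<i> \<i>"
        by (rule linear_split[OF has_derivative_bounded_linear[OF d2[OF that]]])+
      ultimately show "of_real (h'' z 1 v) - \<i> * of_real (h'' z \<i> v) =
          (of_real (h'' z 1 1) - \<i> * of_real (h'' z \<i> 1)) * v"
        by (simp add: complex_eq_iff algebra_simps)
    qed
    ultimately show ?thesis
      unfolding has_field_derivative_def by (rule subst[rotated])
  qed
  then have "\<phi> holomorphic_on ball z0 R"
    using assms(2) unfolding holomorphic_on_def
    by (meson field_differentiable_at_within field_differentiable_def subsetD)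
  then obtain F where "\<And>w. w \<in> ball z0 R \<Longrightarrow> (F has_field_derivative \<phi> w) (at w within ball z0 R)"
    by (rule holomorphic_convex_primitive'[OF convex_ball open_ball]) (rule that)
  then have F: "(F has_field_derivative \<phi> w) (at w)" if "w \<in> ball z0 R" for w
    using that by (metis at_within_open open_ball)
  have "((\<lambda>w. h w - Re (F w)) has_derivative (\<lambda>v. 0)) (at w within ball z0 R)" if "w \<in> ball z0 R" for w
  proof -
    have "w \<in> M" using that assms(2) by blast
    have "((\<lambda>w. h w - Re (F w)) has_derivative (\<lambda>v. h' w v - Re (\<phi> w * v))) (at w)"
      using F[OF that] by (intro has_derivative_diff d1 has_derivative_Re \<open>w \<in> M\<close>) (simp add: has_field_derivative_def)
    moreover have "h' w v - Re (\<phi> w * v) = 0" for v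
      using linear_split[OF has_derivative_bounded_linear[OF d1[OF \<open>w \<in> M\<close>]], of v]
      by (simp add: \<phi>_def)
    ultimately show ?thesis
      by (simp add: has_derivative_at_withinI)
  qed
  from has_derivative_zero_constant[OF convex_ball this]
  obtain c where c: "\<forall>w\<in>ball z0 R. h w - Re (F w) = c"
    by blast
  show ?thesis
  proof (rule that)
    show "((\<lambda>w. F w + of_real c) has_field_derivative \<phi> w) (at w)" if "w \<in> ball z0 R" for w
      using F[OF that] by (auto intro!: derivative_eq_intros)
    show "h w = Re (F w + of_real c)" if "w \<in> ball z0 R" for w
      using c that by (simp add: algebra_simps)
  qed
qed

section \<open>Logarithmic potentials on a circle\<close>

text \<open>The velocity of the circle path is \<open>2 * pi * \<i>\<close> times its displacement
  from \<open>z0\<close>; dividing by this constant turns a contour integral into an average over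
  the circle.\<close>

lemma has_contour_integral_circlepathD:
  assumes "(f has_contour_integral I) (circlepath z0 r)"
  shows "((\<lambda>t. f (circlepath z0 r t) * (circlepath z0 r t - z0)) has_integral I / (2 * of_real pi * \<i>)) {0..1}"
proof -
  have "((\<lambda>t. f (circlepath z0 r t) * vector_derivative (circlepath z0 r) (at t within {0..1})) has_integral I) {0..1}"
    using assms by (simp add: has_contour_integral_def)
  then have "((\<lambda>t. f (circlepath z0 r t) * vector_derivative (circlepath z0 r) (at t within {0..1}) * (1 / (2 * of_real pi * \<i>)))
      has_integral I * (1 / (2 * of_real pi * \<i>))) {0..1}"
    by (rule has_integral_mult_left)
  then show ?thesis
    by (rule has_integral_eq_rhs[OF has_integral_eq, rotated])
       (simp_all add: vector_derivative_circlepath01, simp add: circlepath mult_ac)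
qed

text \<open>On the circle \<open>Re ((w - z0) * f' w)\<close> is \<open>r\<close> times the radial
  derivative of \<open>Re f\<close>, so this evaluates a single layer potential whose density is a
  normal derivative. The factor one half appears because, of the logarithm and its conjugate, only
  one contributes.\<close>

lemma has_integral_ln_dist_circlepath:
  assumes f: "\<And>w. w \<in> ball z0 \<rho> \<Longrightarrow> (f has_field_derivative f' w) (at w)"
    and r: "0 < r" "r < \<rho>" and z: "z \<in> ball z0 r"
  shows "((\<lambda>t. ln (cmod (z - circlepath z0 r t)) * Re ((circlepath z0 r t - z0) * f' (circlepath z0 r t)))
    has_integral - (Re (f z) - Re (f z0)) / 2) {0..1}"
proof -
  let ?c = "circlepath z0 r"
  define L where "L w = Ln (1 - (z - z0) / (w - z0))" for w
  define M where "M w = Ln (1 - cnj (z - z0) * (w - z0) / (of_real r)\<^sup>2)" for w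
  define g where "g t = (?c t - z0) * f' (?c t)" for t
  have zr: "cmod (z - z0) < r"
    using z by (simp add: dist_norm norm_minus_commute)
  have hol: "f holomorphic_on ball z0 \<rho>"
    using f by (subst holomorphic_on_open) blast+
  have f'_eq: "f' w = deriv f w" if "w \<in> ball z0 \<rho>" for w
    using f[OF that] by (simp add: DERIV_imp_deriv)
  have hol': "f' holomorphic_on ball z0 \<rho>"
    using holomorphic_deriv[OF hol open_ball] f'_eq by (metis holomorphic_transform)
  have one: "1 - u \<notin> \<real>\<^sub>\<le>\<^sub>0" if "cmod u < 1" for u
    using that by (auto simp: complex_nonpos_Reals_iff) (smt (verit) abs_Re_le_cmod)
  have img: "path_image ?c \<subseteq> ball z0 \<rho>"
    using r by auto
  have c: "cmod (?c t - z0) = r" for t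
    using r by (simp add: circlepath norm_mult)
  have ne: "?c t \<noteq> z0" for t
    using c[of t] r by auto
  \<comment> \<open>On the circle \<open>cnj (w - z0)\<close> equals \<open>r^2 / (w - z0)\<close>;
    this reflection makes the conjugate of \<open>L\<close> a holomorphic function of
    \<open>w\<close>.\<close>
  have LM: "M (?c t) = cnj (L (?c t))" for t
  proof -
    have "(?c t - z0) * cnj (?c t - z0) = (of_real r)\<^sup>2"
      using complex_norm_square[of "?c t - z0"] c[of t] by simp
    moreover have "cnj u * v / (v * cnj v) = cnj (u / v)" if "v \<noteq> 0" for u v
      using that by simp
    ultimately have "cnj (z - z0) * (?c t - z0) / (of_real r)\<^sup>2 = cnj ((z - z0) / (?c t - z0))"
      using ne[of t] by (metis right_minus_eq)
    moreover have "1 - (z - z0) / (?c t - z0) \<notin> \<real>\<^sub>\<le>\<^sub>0"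
      using zr c[of t] r by (intro one) (simp add: norm_divide)
    ultimately show ?thesis
      unfolding L_def M_def by (simp add: cnj_Ln)
  qed
  have ln_eq: "ln (cmod (z - ?c t)) = ln r + Re (L (?c t))" for t
  proof -
    have "z \<noteq> ?c t"
      using zr c[of t] by auto
    moreover have "1 - (z - z0) / (?c t - z0) = (?c t - z) / (?c t - z0)"
      using ne[of t] by (simp add: field_simps)
    ultimately show ?thesis
      using ne[of t] c[of t] r by (simp add: L_def norm_divide ln_div norm_minus_commute)
  qed
  \<comment> \<open>On the circle \<open>cnj L\<close> agrees with \<open>M\<close>, which is holomorphic inside, so of
    \<open>2 * Re g * Re L = Re (g * L) + Re (g * cnj L)\<close> only the first term contributes.\<close>
  have I1: "(g has_integral 0) {0..1}"
  proof -
    have "(f' has_contour_integral 0) ?c"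
      by (rule Cauchy_theorem_disc_simple[OF hol' _ img]) auto
    from has_contour_integral_circlepathD[OF this] show ?thesis
      by (simp add: g_def[abs_def] mult.commute)
  qed
  have I2: "((\<lambda>t. g t * M (?c t)) has_integral 0) {0..1}"
  proof -
    \<comment> \<open>\<open>M\<close> is holomorphic where
      \<open>|z - z0| * |w - z0| < r^2\<close>. The midpoint \<open>m\<close> lies strictly between
      \<open>|z - z0|\<close> and \<open>r\<close> and is positive even for \<open>z = z0\<close>,
      so \<open>r^2 / m\<close> is a well-defined radius larger than \<open>r\<close>.\<close>
    define m where "m = (cmod (z - z0) + r) / 2"
    define R where "R = min \<rho> (r\<^sup>2 / m)"
    have m: "cmod (z - z0) < m" "m < r" "m > 0"
      using zr r norm_ge_zero[of "z - z0"] by (simp_all add: m_def del: norm_ge_zero)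
    have "r < r\<^sup>2 / m"
      using m r by (simp add: pos_less_divide_eq power2_eq_square)
    then have R: "r < R" "R \<le> \<rho>"
      using r by (auto simp: R_def)
    have "(\<lambda>w. f' w * M w) holomorphic_on ball z0 R"
      unfolding M_def
    proof (intro holomorphic_intros one)
      show "f' holomorphic_on ball z0 R"
        using hol' R by (auto elim: holomorphic_on_subset)
    next
      fix w assume "w \<in> ball z0 R"
      then have w: "cmod (w - z0) < R" by (simp add: dist_norm norm_minus_commute)
      have "cmod (z - z0) * cmod (w - z0) \<le> m * cmod (w - z0)"
        using m by (intro mult_right_mono) auto
      also have "\<dots> < m * R"
        using m w by (intro mult_strict_left_mono)
      also have "\<dots> \<le> m * (r\<^sup>2 / m)"
        using m by (intro mult_left_mono) (auto simp: R_def)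
      also have "\<dots> = r\<^sup>2"
        using m by simp
      finally show "cmod (cnj (z - z0) * (w - z0) / (of_real r)\<^sup>2) < 1"
        using r by (simp add: norm_mult norm_divide norm_power flip: complex_cnj_diff)
    qed (use r in auto)
    then have "((\<lambda>w. f' w * M w) has_contour_integral 0) ?c"
      using R r by (intro Cauchy_theorem_disc_simple) auto
    from has_contour_integral_circlepathD[OF this] show ?thesis
      by (simp add: g_def mult_ac)
  qed
  \<comment> \<open>Integrating by parts turns \<open>f' * L\<close> into \<open>- f * L'\<close>, a difference of two Cauchy kernels.\<close>
  have I3: "((\<lambda>t. g t * L (?c t)) has_integral - (f z - f z0)) {0..1}"
  proof -
    have dL: "(L has_field_derivative (1 / (w - z) - 1 / (w - z0))) (at w)"
      if "cmod (z - z0) < cmod (w - z0)" for w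
    proof -
      have "w \<noteq> z0" "w \<noteq> z" using that by auto
      moreover have "1 - (z - z0) / (w - z0) \<notin> \<real>\<^sub>\<le>\<^sub>0"
        using that \<open>w \<noteq> z0\<close> by (intro one) (auto simp: norm_divide)
      ultimately have "(L has_field_derivative - (inverse (1 - (z - z0) / (w - z0)) * (z0 - z) / ((w - z0) * (w - z0)))) (at w)"
        unfolding L_def by (auto intro!: derivative_eq_intros)
      moreover have "- (inverse (1 - (a - b) / a) * (b - a) / (a * a)) = 1 / b - 1 / a" if "a \<noteq> 0" "b \<noteq> 0" for a b :: complex
        using that by (simp add: field_simps)
      from this[of "w - z0" "w - z"] have "- (inverse (1 - (z - z0) / (w - z0)) * (z0 - z) / ((w - z0) * (w - z0))) = 1 / (w - z) - 1 / (w - z0)"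
        using \<open>w \<noteq> z0\<close> \<open>w \<noteq> z\<close> by simp
      ultimately show ?thesis
        by simp
    qed
    have *: "((\<lambda>w. f w * L w) has_field_derivative f' w * L w + f w * (1 / (w - z) - 1 / (w - z0))) (at w within sphere z0 r)"
      if "w \<in> sphere z0 r" for w
    proof -
      have "w \<in> ball z0 \<rho>" "cmod (z - z0) < cmod (w - z0)"
        using that r zr by (auto simp: dist_norm norm_minus_commute)
      then have "((\<lambda>w. f w * L w) has_field_derivative f' w * L w + f w * (1 / (w - z) - 1 / (w - z0))) (at w)"
        by (auto intro!: derivative_eq_intros f dL)
      then show ?thesis
        by (rule has_field_derivative_at_within)
    qed
    have "((\<lambda>w. f' w * L w + f w * (1 / (w - z) - 1 / (w - z0))) has_contour_integral 0) ?c"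
      using contour_integral_primitive[OF *, of ?c] r by simp
    moreover have "f holomorphic_on cball z0 r"
      using hol r by (auto elim!: holomorphic_on_subset)
    then have "((\<lambda>w. f w / (w - z) - f w / (w - z0)) has_contour_integral
        (2 * of_real pi * \<i> * f z - 2 * of_real pi * \<i> * f z0)) ?c"
      using r zr by (intro has_contour_integral_diff Cauchy_integral_circlepath_simple) auto
    ultimately have "((\<lambda>w. (f' w * L w + f w * (1 / (w - z) - 1 / (w - z0))) - (f w / (w - z) - f w / (w - z0)))
       has_contour_integral 0 - (2 * of_real pi * \<i> * f z - 2 * of_real pi * \<i> * f z0)) ?c"
      by (rule has_contour_integral_diff)
    then have "((\<lambda>w. f' w * L w) has_contour_integral - (2 * of_real pi * \<i> * (f z - f z0))) ?c"
      by (simp add: algebra_simps)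
    from has_contour_integral_circlepathD[OF this] show ?thesis
      by (rule has_integral_eq_rhs[OF has_integral_eq, rotated]) (auto simp: g_def)
  qed
  \<comment> \<open>The constant \<open>ln r\<close> drops out because the radial derivative has
    mean zero on the circle, which is the real part of \<open>I1\<close>.\<close>
  have "((\<lambda>t. ln r * Re (g t) + Re (g t * L (?c t) + g t * M (?c t)) / 2) has_integral
      ln r * Re 0 + Re (- (f z - f z0) + 0) / 2) {0..1}"
    by (intro has_integral_add has_integral_mult_right has_integral_divide has_integral_Re I1 I2 I3)
  then show ?thesis
    by (rule has_integral_eq_rhs[OF has_integral_eq, rotated])
       (simp_all add: LM ln_eq flip: g_def, simp add: algebra_simps)
qed

section \<open>Sums of measures\<close>

definition measure_plus :: "'a measure \<Rightarrow> 'a measure \<Rightarrow> 'a measure" where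
  "measure_plus \<mu> \<nu> = measure_of (space \<mu>) (sets \<mu>) (\<lambda>A. emeasure \<mu> A + emeasure \<nu> A)"

lemma sets_measure_plus [simp, measurable_cong]: "sets (measure_plus \<mu> \<nu>) = sets \<mu>"
  by (simp add: measure_plus_def)

lemma space_measure_plus [simp]: "space (measure_plus \<mu> \<nu>) = space \<mu>"
  by (simp add: measure_plus_def)

lemma emeasure_measure_plus:
  assumes "sets \<nu> = sets \<mu>" "A \<in> sets \<mu>"
  shows "emeasure (measure_plus \<mu> \<nu>) A = emeasure \<mu> A + emeasure \<nu> A"
  unfolding measure_plus_def
proof (rule emeasure_measure_of_sigma)
  show "sigma_algebra (space \<mu>) (sets \<mu>)" ..
  show "positive (sets \<mu>) (\<lambda>A. emeasure \<mu> A + emeasure \<nu> A)"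
    by (simp add: positive_def)
  show "countably_additive (sets \<mu>) (\<lambda>A. emeasure \<mu> A + emeasure \<nu> A)"
    using assms(1) by (auto simp: countably_additive_def suminf_add[symmetric] suminf_emeasure)
qed fact

lemma nn_integral_measure_plus:
  assumes "sets \<nu> = sets \<mu>" "f \<in> borel_measurable \<mu>"
  shows "(\<integral>\<^sup>+x. f x \<partial>measure_plus \<mu> \<nu>) = (\<integral>\<^sup>+x. f x \<partial>\<mu>) + (\<integral>\<^sup>+x. f x \<partial>\<nu>)"
proof -
  note [measurable_cong] = assms(1)
  have sp: "space \<nu> = space \<mu>"
    using sets_eq_imp_space_eq[OF assms(1)] .
  from assms(2) show ?thesis
  proof (induction f rule: borel_measurable_induct)
    case (cong f g)
    then show ?case
      by (simp add: sp cong: nn_integral_cong_simp)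
  next
    case (set A)
    then show ?case
      using assms(1) by (simp add: emeasure_measure_plus)
  next
    case (mult u c)
    then have [measurable]: "u \<in> borel_measurable \<nu>" "u \<in> borel_measurable (measure_plus \<mu> \<nu>)"
      by (auto cong: measurable_cong_sets simp: assms)
    show ?case
      using mult by (simp add: nn_integral_cmult distrib_left)
  next
    case (add u v)
    then have [measurable]: "u \<in> borel_measurable \<nu>" "u \<in> borel_measurable (measure_plus \<mu> \<nu>)"
        "v \<in> borel_measurable \<nu>" "v \<in> borel_measurable (measure_plus \<mu> \<nu>)"
      by (auto cong: measurable_cong_sets simp: assms)
    show ?case
      using add by (simp add: nn_integral_add ac_simps)
  next
    case (seq U)
    then have [measurable]: "U i \<in> borel_measurable \<nu>" "U i \<in> borel_measurable (measure_plus \<mu> \<nu>)" for i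
      by (auto cong: measurable_cong_sets simp: assms)
    have inc: "incseq (\<lambda>i. \<integral>\<^sup>+x. U i x \<partial>N)" for N
      using \<open>incseq U\<close> by (auto simp: incseq_def le_fun_def intro!: nn_integral_mono)
    have sup: "(SUP i. U i) x = (SUP i. U i x)" for x
      by (simp add: image_image)
    show ?case
      unfolding sup using seq
      by (simp add: nn_integral_monotone_convergence_SUP ennreal_SUP_add inc)
  qed
qed

text \<open>Additivity in the extended reals needs control of the infinities. The positive part is
  finite for \<open>\<mu>\<close> and both parts are finite for \<open>\<nu>\<close>, so the only
  infinite value that can arise is the negative one coming from \<open>\<mu>\<close>.\<close>

lemma pot_measure_plus:
  assumes sets: "sets \<mu> = sets borel" "sets \<nu> = sets borel"
    and fin: "(\<integral>\<^sup>+\<zeta>. ennreal (ln (cmod (z - \<zeta>))) \<partial>\<mu>) < \<infinity>"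
    and int: "integrable \<nu> (\<lambda>\<zeta>. ln (cmod (z - \<zeta>)))" and ne: "AE \<zeta> in \<nu>. \<zeta> \<noteq> z"
  shows "pot (measure_plus \<mu> \<nu>) z = pot \<mu> z + ereal (1 / (2 * pi) * (\<integral>\<zeta>. ln (cmod (z - \<zeta>)) \<partial>\<nu>))"
proof -
  note [measurable_cong] = sets
  define p where "p \<zeta> = ennreal (max 0 (ln (cmod (z - \<zeta>))))" for \<zeta>
  define n where "n \<zeta> = (if \<zeta> = z then \<infinity> else ennreal (max 0 (- ln (cmod (z - \<zeta>)))))" for \<zeta>
  have [measurable]: "p \<in> borel_measurable borel" "n \<in> borel_measurable borel"
    unfolding p_def n_def by measurable
  define a1 where "a1 = enn2real (\<integral>\<^sup>+\<zeta>. p \<zeta> \<partial>\<mu>)"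
  define b1 where "b1 = (\<integral>\<^sup>+\<zeta>. n \<zeta> \<partial>\<mu>)"
  define a2 where "a2 = enn2real (\<integral>\<^sup>+\<zeta>. ennreal (ln (cmod (z - \<zeta>))) \<partial>\<nu>)"
  define b2 where "b2 = enn2real (\<integral>\<^sup>+\<zeta>. ennreal (- ln (cmod (z - \<zeta>))) \<partial>\<nu>)"
  have nn: "a1 \<ge> 0" "a2 \<ge> 0" "b2 \<ge> 0"
    by (simp_all add: a1_def a2_def b2_def)
  have max0: "ennreal (max 0 x) = ennreal x" for x
    by (metis ennreal_max_0)
  have 1: "(\<integral>\<^sup>+\<zeta>. p \<zeta> \<partial>\<mu>) = ennreal a1"
    using fin by (simp add: a1_def p_def max0)
  have 2: "(\<integral>\<^sup>+\<zeta>. p \<zeta> \<partial>\<nu>) = ennreal a2"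
    using int by (simp add: a2_def p_def max0 real_integrable_def less_top)
  have "(\<integral>\<^sup>+\<zeta>. n \<zeta> \<partial>\<nu>) = (\<integral>\<^sup>+\<zeta>. ennreal (- ln (cmod (z - \<zeta>))) \<partial>\<nu>)"
    using ne by (intro nn_integral_cong_AE) (auto simp: n_def max0 elim!: eventually_mono)
  also have "\<dots> = ennreal b2"
    using int by (simp add: b2_def real_integrable_def less_top)
  finally have 3: "(\<integral>\<^sup>+\<zeta>. n \<zeta> \<partial>\<nu>) = ennreal b2" .
  have I: "(\<integral>\<zeta>. ln (cmod (z - \<zeta>)) \<partial>\<nu>) = a2 - b2"
    using int by (simp add: real_lebesgue_integral_def a2_def b2_def)
  have "pot (measure_plus \<mu> \<nu>) z = ereal (1 / (2 * pi)) *
      (enn2ereal (ennreal a1 + ennreal a2) - enn2ereal (b1 + ennreal b2))"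
    unfolding pot_def p_def[symmetric] n_def[symmetric]
    using sets by (simp add: nn_integral_measure_plus 1 2 3 b1_def)
  \<comment> \<open>Only \<open>b1\<close> can be infinite, and in that case both sides are negative
    infinity.\<close>
  also have "\<dots> = ereal (1 / (2 * pi)) * (enn2ereal (ennreal a1) - enn2ereal b1) + ereal (1 / (2 * pi) * (a2 - b2))"
    using nn by (cases b1) (simp_all add: ennreal_plus[symmetric] algebra_simps diff_divide_distrib add_divide_distrib del: ennreal_plus)
  finally show ?thesis
    unfolding pot_def p_def[symmetric] n_def[symmetric] 1 I b1_def .
qed

section \<open>Sweeping onto a circle\<close>

text \<open>For positive \<open>r\<close> this is arc length divided by \<open>2 * pi * r\<close>.
  Densities against it are therefore \<open>2 * pi * r\<close> times densities per unit length,
  which is why radial derivatives occur multiplied by \<open>r\<close>.\<close>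

definition circle_measure :: "complex \<Rightarrow> real \<Rightarrow> complex measure" where
  "circle_measure z0 r = distr (restrict_space lborel {0..1}) borel (circlepath z0 r)"

lemma sets_circle_measure [simp, measurable_cong]: "sets (circle_measure z0 r) = sets borel"
  by (simp add: circle_measure_def)

lemma space_circle_measure [simp]: "space (circle_measure z0 r) = UNIV"
  by (simp add: circle_measure_def)

lemma measurable_circlepath:
  "circlepath z0 r \<in> borel_measurable (restrict_space lborel {0..1})"
proof -
  have "continuous_on UNIV (circlepath z0 r)"
    unfolding circlepath by (intro continuous_intros)
  then have "circlepath z0 r \<in> borel_measurable lborel"
    by (simp add: borel_measurable_continuous_onI)
  then show ?thesis
    by (rule measurable_restrict_space1)
qed

lemma emeasure_circle_measure_UNIV [simp]: "emeasure (circle_measure z0 r) UNIV = 1"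
  unfolding circle_measure_def
  by (subst emeasure_distr[OF measurable_circlepath])
     (auto simp: emeasure_restrict_space space_restrict_space)

lemma finite_measure_circle_measure: "finite_measure (circle_measure z0 r)"
  by (rule finite_measureI) simp

lemma circlepath_in_sphere: "0 \<le> r \<Longrightarrow> circlepath z0 r t \<in> sphere z0 r"
  by (simp add: circlepath dist_norm norm_mult)

lemma AE_circle_measure: "0 \<le> r \<Longrightarrow> AE w in circle_measure z0 r. w \<in> sphere z0 r"
  unfolding circle_measure_def
  by (subst AE_distr_iff[OF measurable_circlepath]) (auto simp del: mem_sphere intro: circlepath_in_sphere)

lemma integrable_circle_measure:
  fixes f :: "complex \<Rightarrow> real"
  assumes "0 \<le> r" and "f \<in> borel_measurable borel" and "\<And>w. w \<in> sphere z0 r \<Longrightarrow> \<bar>f w\<bar> \<le> b"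
  shows "integrable (circle_measure z0 r) f"
proof -
  interpret finite_measure "circle_measure z0 r" by (rule finite_measure_circle_measure)
  show ?thesis
    using AE_circle_measure[OF assms(1), of z0] assms
    by (intro integrable_const_bound[where B = b]) (auto elim!: eventually_mono)
qed

text \<open>The circle identities are gauge integrals over the parameter. The bound on
  \<open>f\<close> supplies Lebesgue integrability, after which the two integrals coincide.\<close>

lemma integral_circle_measure:
  fixes f :: "complex \<Rightarrow> real"
  assumes "0 \<le> r" and f: "f \<in> borel_measurable borel" and b: "\<And>w. w \<in> sphere z0 r \<Longrightarrow> \<bar>f w\<bar> \<le> b"
    and I: "((\<lambda>t. f (circlepath z0 r t)) has_integral I) {0..1}"
  shows "(\<integral>w. f w \<partial>circle_measure z0 r) = I"
proof -
  have "integrable (restrict_space lborel {0..1}) (\<lambda>t. f (circlepath z0 r t))"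
    using integrable_circle_measure[OF assms(1-3)] f
    unfolding circle_measure_def by (simp add: integrable_distr_eq[OF measurable_circlepath])
  then have *: "set_integrable lborel {0..1} (\<lambda>t. f (circlepath z0 r t))"
    by (simp add: integrable_restrict_space set_integrable_def)
  have "(\<integral>w. f w \<partial>circle_measure z0 r) = (\<integral>t. f (circlepath z0 r t) \<partial>restrict_space lborel {0..1})"
    unfolding circle_measure_def by (rule integral_distr[OF measurable_circlepath f])
  also have "\<dots> = (LINT t:{0..1}|lborel. f (circlepath z0 r t))"
    by (simp add: integral_restrict_space set_lebesgue_integral_def)
  also have "\<dots> = I"
    using set_borel_integral_eq_integral(2)[OF *] I by (simp add: integral_unique)
  finally show ?thesis .
qed

lemma continuous_on_field_derivative:
  fixes f :: "complex \<Rightarrow> complex"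
  assumes "open S" "\<And>w. w \<in> S \<Longrightarrow> (f has_field_derivative f' w) (at w)"
  shows "continuous_on S f'"
proof -
  have "f holomorphic_on S"
    unfolding holomorphic_on_def using assms(2)
    by (meson field_differentiable_at_within field_differentiable_def)
  then have "continuous_on S (deriv f)"
    by (intro holomorphic_on_imp_continuous_on holomorphic_deriv assms(1))
  moreover have "deriv f w = f' w" if "w \<in> S" for w
    using assms(2)[OF that] by (simp add: DERIV_imp_deriv)
  ultimately show ?thesis
    by (metis (mono_tags, lifting) continuous_on_cong)
qed

lemma integral_ln_dist_circle_measure:
  assumes f: "\<And>w. w \<in> ball z0 \<rho> \<Longrightarrow> (f has_field_derivative f' w) (at w)"
    and f': "f' \<in> borel_measurable borel"
    and r: "0 < r" "r < \<rho>" and z: "z \<in> ball z0 r"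
  shows "(\<integral>w. ln (cmod (z - w)) * Re ((w - z0) * f' w) \<partial>circle_measure z0 r) = - (Re (f z) - Re (f z0)) / 2"
proof -
  have "continuous_on (ball z0 \<rho>) f'"
    by (rule continuous_on_field_derivative[OF open_ball f])
  then have "continuous_on (sphere z0 r) f'"
    using r by (elim continuous_on_subset) auto
  moreover have "z \<notin> sphere z0 r"
    using z by auto
  ultimately have "continuous_on (sphere z0 r) (\<lambda>w. ln (cmod (z - w)) * Re ((w - z0) * f' w))"
    by (auto intro!: continuous_intros)
  then have "compact ((\<lambda>w. ln (cmod (z - w)) * Re ((w - z0) * f' w)) ` sphere z0 r)"
    by (intro compact_continuous_image) auto
  then obtain b where "\<And>w. w \<in> sphere z0 r \<Longrightarrow> \<bar>ln (cmod (z - w)) * Re ((w - z0) * f' w)\<bar> \<le> b"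
    by (force dest!: compact_imp_bounded simp: bounded_iff)
  then show ?thesis
    using f' r by (intro integral_circle_measure has_integral_ln_dist_circlepath[OF f r z]) auto
qed

lemma ln_dist_sphere_bound:
  assumes "z \<in> ball z0 r"
  obtains b where "b \<ge> 0" "\<And>w. w \<in> sphere z0 r \<Longrightarrow> \<bar>ln (cmod (z - w))\<bar> \<le> b"
proof -
  have "continuous_on (sphere z0 r) (\<lambda>w. ln (cmod (z - w)))"
    using assms by (auto intro!: continuous_intros)
  then have "bounded ((\<lambda>w. ln (cmod (z - w))) ` sphere z0 r)"
    by (intro compact_imp_bounded compact_continuous_image) auto
  then obtain b where "b > 0" "\<And>w. w \<in> sphere z0 r \<Longrightarrow> \<bar>ln (cmod (z - w))\<bar> \<le> b"
    by (auto simp: bounded_pos)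
  then show ?thesis
    using that[of b] by auto
qed

text \<open>Up to the factor \<open>-2\<close>, this is the density on the circle through \<open>w\<close> centred at
  \<open>z0\<close> of the measure obtained by sweeping the part of \<open>\<mu>\<close> outside \<open>ball z0 \<rho>\<close> onto that
  circle: the kernel is \<open>r\<close> times the radial derivative of \<open>ln |w - \<zeta>|\<close>.\<close>
definition swept :: "complex measure \<Rightarrow> complex \<Rightarrow> real \<Rightarrow> complex \<Rightarrow> real" where
  "swept \<mu> z0 \<rho> w = (\<integral>\<zeta>. indicator (- ball z0 \<rho>) \<zeta> * Re ((w - z0) / (w - \<zeta>)) \<partial>\<mu>)"

lemma fin_borelD:
  assumes "fin_borel \<mu>"
  shows "finite_measure \<mu>" "sets \<mu> = sets borel" "space \<mu> = UNIV"
  using assms sets_eq_imp_space_eq[of \<mu> borel]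
  by (auto simp: fin_borel_def intro!: finite_measureI)

lemma swept_measurable [measurable]:
  assumes "fin_borel \<mu>"
  shows "swept \<mu> z0 \<rho> \<in> borel_measurable borel"
proof -
  interpret finite_measure \<mu> by (rule fin_borelD[OF assms])
  note [measurable_cong] = fin_borelD(2)[OF assms]
  show ?thesis
    unfolding swept_def[abs_def] by measurable
qed

section \<open>Size and potential of the swept measure\<close>

lemma sweep_kernel_bound:
  assumes "0 < r" "r < \<rho>" "w \<in> sphere z0 r" "\<rho> \<le> dist z0 \<zeta>"
  shows "\<bar>Re ((w - z0) / (w - \<zeta>))\<bar> \<le> r / (dist z0 \<zeta> - r)"
proof -
  have "cmod (w - z0) = r"
    using assms(3) by (simp add: dist_norm norm_minus_commute)
  moreover have "dist z0 \<zeta> - r \<le> cmod (w - \<zeta>)"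
    using assms(3) dist_triangle[of z0 \<zeta> w] by (simp add: dist_norm)
  ultimately have "cmod ((w - z0) / (w - \<zeta>)) \<le> r / (dist z0 \<zeta> - r)"
    using assms by (simp add: norm_divide) (intro divide_left_mono mult_pos_pos, auto)
  then show ?thesis
    using abs_Re_le_cmod order_trans by blast
qed

text \<open>Two scales are separated. Swept points within \<open>s\<close> of \<open>z0\<close> cost
  at most \<open>r / (\<rho> - r)\<close>, which is not small but multiplies only the mass of a
  punctured disc; points farther away cost at most \<open>r / (s - r)\<close>, which is small for
  small \<open>r\<close>.\<close>

lemma swept_bound:
  assumes "fin_borel \<mu>" "0 < r" "r < \<rho>" "r < s" "w \<in> sphere z0 r"
  shows "\<bar>swept \<mu> z0 \<rho> w\<bar> \<le> r / (\<rho> - r) * measure \<mu> (ball z0 s - {z0}) + r / (s - r) * measure \<mu> UNIV"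
proof -
  interpret finite_measure \<mu> by (rule fin_borelD[OF assms(1)])
  note [measurable_cong] = fin_borelD(2)[OF assms(1)]
  have sp: "space \<mu> = UNIV" by (rule fin_borelD[OF assms(1)])
  define k where "k \<zeta> = indicator (- ball z0 \<rho>) \<zeta> * Re ((w - z0) / (w - \<zeta>))" for \<zeta>
  have le: "\<bar>k \<zeta>\<bar> \<le> r / (\<rho> - r) * indicator (ball z0 s - {z0}) \<zeta> + r / (s - r)" for \<zeta>
  proof (cases "\<zeta> \<in> ball z0 \<rho>")
    case True
    then show ?thesis
      using assms by (auto simp: k_def)
  next
    case False
    then have d: "\<rho> \<le> dist z0 \<zeta>" by simp
    then have "\<zeta> \<noteq> z0" using assms by auto
    have k: "\<bar>k \<zeta>\<bar> \<le> r / (dist z0 \<zeta> - r)"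
      using sweep_kernel_bound[OF assms(2,3,5) d] False by (simp add: k_def)
    show ?thesis
    proof (cases "dist z0 \<zeta> < s")
      case True
      have "r / (dist z0 \<zeta> - r) \<le> r / (\<rho> - r)"
        using assms d by (intro divide_left_mono mult_pos_pos) auto
      then show ?thesis
        using k True \<open>\<zeta> \<noteq> z0\<close> assms by (simp add: add_increasing2)
    next
      case False
      have "r / (dist z0 \<zeta> - r) \<le> r / (s - r)"
        using assms d False by (intro divide_left_mono mult_pos_pos) auto
      then show ?thesis
        using k False by simp
    qed
  qed
  have sets: "ball z0 s - {z0} \<in> sets \<mu>"
    using fin_borelD(2)[OF assms(1)] by simp
  have int: "integrable \<mu> (\<lambda>\<zeta>. r / (\<rho> - r) * indicator (ball z0 s - {z0}) \<zeta> + r / (s - r))"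
    using sets by (auto intro!: integrable_add integrable_mult_right simp: emeasure_eq_measure)
  have "\<bar>swept \<mu> z0 \<rho> w\<bar> \<le> (\<integral>\<zeta>. \<bar>k \<zeta>\<bar> \<partial>\<mu>)"
    unfolding swept_def k_def by (rule integral_abs_bound)
  also have "\<dots> \<le> (\<integral>\<zeta>. r / (\<rho> - r) * indicator (ball z0 s - {z0}) \<zeta> + r / (s - r) \<partial>\<mu>)"
  proof (rule integral_mono')
    show "\<And>\<zeta>. \<bar>k \<zeta>\<bar> \<le> r / (\<rho> - r) * indicator (ball z0 s - {z0}) \<zeta> + r / (s - r)"
      by (rule le)
    show "\<And>\<zeta>. 0 \<le> r / (\<rho> - r) * indicator (ball z0 s - {z0}) \<zeta> + r / (s - r)"
      using le abs_ge_zero order_trans by blast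
  qed (rule int)
  also have "\<dots> = r / (\<rho> - r) * measure \<mu> (ball z0 s - {z0}) + r / (s - r) * measure \<mu> UNIV"
    using sets by (subst Bochner_Integration.integral_add) (auto simp: sp emeasure_eq_measure)
  finally show ?thesis .
qed

text \<open>By Fubini it suffices to sweep one point \<open>\<zeta>\<close> outside the disc. There
  \<open>ln |w - \<zeta>|\<close> is harmonic in \<open>w\<close>, and the circle identity recovers
  its increment from \<open>z0\<close> to \<open>z\<close>.\<close>

lemma integral_ln_dist_swept:
  assumes \<mu>: "fin_borel \<mu>" and r: "0 < r" "r < \<rho>" and z: "z \<in> ball z0 r"
  shows "(\<integral>w. ln (cmod (z - w)) * swept \<mu> z0 \<rho> w \<partial>circle_measure z0 r) =
    - (\<integral>\<zeta>. indicator (- ball z0 \<rho>) \<zeta> * (ln (cmod (z - \<zeta>)) - ln (cmod (z0 - \<zeta>))) \<partial>\<mu>) / 2"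
proof -
  let ?C = "circle_measure z0 r" and ?S = "sphere z0 r"
  interpret M: finite_measure \<mu> by (rule fin_borelD[OF \<mu>])
  interpret C: finite_measure ?C by (rule finite_measure_circle_measure)
  interpret P: pair_sigma_finite ?C \<mu> ..
  interpret P': finite_measure "?C \<Otimes>\<^sub>M \<mu>"
    by (rule finite_measure_pair_measure) unfold_locales
  note [measurable_cong] = fin_borelD(2)[OF \<mu>]
  have closed: "- ball z0 \<rho> \<in> sets borel" "?S \<in> sets borel" by auto
  note [measurable] = closed
  \<comment> \<open>The indicator of the sphere makes the integrand bounded on the whole product
    space, not only almost everywhere.\<close>
  define J where "J w \<zeta> = indicator ?S w * ln (cmod (z - w)) * (indicator (- ball z0 \<rho>) \<zeta> * Re ((w - z0) / (w - \<zeta>)))" for w \<zeta>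
  obtain b where b: "b \<ge> 0" and ln_bound: "\<And>w. w \<in> ?S \<Longrightarrow> \<bar>ln (cmod (z - w))\<bar> \<le> b"
    using ln_dist_sphere_bound[OF z] by blast
  have J_bound: "\<bar>J w \<zeta>\<bar> \<le> b * (r / (\<rho> - r))" for w \<zeta>
  proof (cases "w \<in> ?S \<and> \<zeta> \<notin> ball z0 \<rho>")
    case True
    then have "\<bar>Re ((w - z0) / (w - \<zeta>))\<bar> \<le> r / (dist z0 \<zeta> - r)"
      using r by (intro sweep_kernel_bound) auto
    also have "\<dots> \<le> r / (\<rho> - r)"
      using r True by (intro divide_left_mono mult_pos_pos) auto
    finally have "\<bar>ln (cmod (z - w))\<bar> * \<bar>Re ((w - z0) / (w - \<zeta>))\<bar> \<le> b * (r / (\<rho> - r))"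
      using ln_bound b True by (intro mult_mono) auto
    then show ?thesis
      using True by (simp add: J_def abs_mult)
  next
    case False
    then show ?thesis
      using b r by (auto simp: J_def)
  qed
  have "integrable (?C \<Otimes>\<^sub>M \<mu>) (\<lambda>(w, \<zeta>). J w \<zeta>)"
  proof (rule P'.integrable_const_bound)
    show "AE x in ?C \<Otimes>\<^sub>M \<mu>. norm (case x of (w, \<zeta>) \<Rightarrow> J w \<zeta>) \<le> b * (r / (\<rho> - r))"
      using J_bound by (auto split: prod.splits)
    show "(\<lambda>(w, \<zeta>). J w \<zeta>) \<in> borel_measurable (?C \<Otimes>\<^sub>M \<mu>)"
      unfolding J_def by measurable
  qed
  from P.Fubini_integral[OF this]
  have "(\<integral>w. \<integral>\<zeta>. J w \<zeta> \<partial>\<mu> \<partial>?C) = (\<integral>\<zeta>. \<integral>w. J w \<zeta> \<partial>?C \<partial>\<mu>)"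
    by simp
  moreover have "(\<integral>w. \<integral>\<zeta>. J w \<zeta> \<partial>\<mu> \<partial>?C) = (\<integral>w. ln (cmod (z - w)) * swept \<mu> z0 \<rho> w \<partial>?C)"
  proof (rule integral_cong_AE)
    show "AE w in ?C. (\<integral>\<zeta>. J w \<zeta> \<partial>\<mu>) = ln (cmod (z - w)) * swept \<mu> z0 \<rho> w"
      using AE_circle_measure[of r z0] r
      by (auto simp: J_def swept_def simp del: mem_sphere elim!: eventually_mono)
    show "(\<lambda>w. \<integral>\<zeta>. J w \<zeta> \<partial>\<mu>) \<in> borel_measurable ?C"
      unfolding J_def by measurable
    show "(\<lambda>w. ln (cmod (z - w)) * swept \<mu> z0 \<rho> w) \<in> borel_measurable ?C"
      using swept_measurable[OF \<mu>, measurable] by measurable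
  qed
  moreover have "(\<integral>w. J w \<zeta> \<partial>?C) = - (indicator (- ball z0 \<rho>) \<zeta> * (ln (cmod (z - \<zeta>)) - ln (cmod (z0 - \<zeta>)))) / 2" for \<zeta>
  proof (cases "\<zeta> \<in> ball z0 \<rho>")
    case True
    then show ?thesis by (simp add: J_def)
  next
    case False
    then have d: "\<rho> \<le> cmod (\<zeta> - z0)" by (simp add: dist_norm norm_minus_commute)
    \<comment> \<open>A branch of the logarithm of \<open>w - \<zeta>\<close>, normalized by
      \<open>f z0 = 0\<close>. The quotient has modulus below 1 on the disc, so the branch cut is
      avoided, and the derivative \<open>1 / (w - \<zeta>)\<close> produces exactly the sweep
      kernel.\<close>
    define f where "f w = Ln (1 - (w - z0) / (\<zeta> - z0))" for w
    have ne: "\<zeta> \<noteq> z0" using d r by auto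
    have *: "1 - (w - z0) / (\<zeta> - z0) \<notin> \<real>\<^sub>\<le>\<^sub>0" "\<zeta> \<noteq> w" if "w \<in> ball z0 \<rho>" for w
    proof -
      have "cmod (w - z0) < cmod (\<zeta> - z0)"
        using that d by (simp add: dist_norm norm_minus_commute)
      then have "cmod ((w - z0) / (\<zeta> - z0)) < 1"
        using ne by (simp add: norm_divide)
      then show "1 - (w - z0) / (\<zeta> - z0) \<notin> \<real>\<^sub>\<le>\<^sub>0"
        by (auto simp: complex_nonpos_Reals_iff) (smt (verit) abs_Re_le_cmod)
      show "\<zeta> \<noteq> w" using that False by auto
    qed
    have df: "(f has_field_derivative 1 / (w - \<zeta>)) (at w)" if "w \<in> ball z0 \<rho>" for w
    proof -
      have "(f has_field_derivative inverse (1 - (w - z0) / (\<zeta> - z0)) * - (1 / (\<zeta> - z0))) (at w)"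
        unfolding f_def using *[OF that] ne by (auto intro!: derivative_eq_intros)
      moreover have "inverse (1 - u / v) * - (1 / v) = 1 / (u - v)" if "v \<noteq> 0" "v \<noteq> u" for u v :: complex
        using that by (simp add: field_simps)
      from this[of "\<zeta> - z0" "w - z0"] have "inverse (1 - (w - z0) / (\<zeta> - z0)) * - (1 / (\<zeta> - z0)) = 1 / (w - \<zeta>)"
        using *[OF that] ne by simp
      ultimately show ?thesis
        by simp
    qed
    have Re_f: "Re (f w) = ln (cmod (w - \<zeta>)) - ln (cmod (z0 - \<zeta>))" if "w \<in> ball z0 \<rho>" for w
    proof -
      have "1 - (w - z0) / (\<zeta> - z0) = (\<zeta> - w) / (\<zeta> - z0)"
        using ne by (simp add: field_simps)
      then show ?thesis
        using *[OF that] ne by (simp add: f_def norm_divide ln_div norm_minus_commute)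
    qed
    have "(\<integral>w. J w \<zeta> \<partial>?C) = (\<integral>w. ln (cmod (z - w)) * Re ((w - z0) * (1 / (w - \<zeta>))) \<partial>?C)"
    proof (rule integral_cong_AE)
      show "AE w in ?C. J w \<zeta> = ln (cmod (z - w)) * Re ((w - z0) * (1 / (w - \<zeta>)))"
        using AE_circle_measure[of r z0] r False
        by (auto simp: J_def simp del: mem_sphere elim!: eventually_mono)
    qed (auto simp: J_def)
    also have "\<dots> = - (Re (f z) - Re (f z0)) / 2"
      using r z by (intro integral_ln_dist_circle_measure[OF df]) auto
    also have "\<dots> = - (indicator (- ball z0 \<rho>) \<zeta> * (ln (cmod (z - \<zeta>)) - ln (cmod (z0 - \<zeta>)))) / 2"
      using r z False Re_f[of z] Re_f[of z0] by simp
    finally show ?thesis .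
  qed
  ultimately show ?thesis
    by simp
qed

section \<open>Splitting the potential at a disc\<close>

lemma density_indicator_real:
  "density \<mu> (indicator A) = density \<mu> (\<lambda>x. ennreal (indicator A x))"
  by (simp add: ennreal_indicator)

lemma measure_plus_restrict_Compl:
  assumes "B \<in> sets \<mu>"
  shows "measure_plus (density \<mu> (indicator B)) (density \<mu> (indicator (space \<mu> - B))) = \<mu>"
proof (rule measure_eqI)
  fix A assume "A \<in> sets (measure_plus (density \<mu> (indicator B)) (density \<mu> (indicator (space \<mu> - B))))"
  then have A: "A \<in> sets \<mu>" by simp
  have "emeasure \<mu> (B \<inter> A) + emeasure \<mu> ((space \<mu> - B) \<inter> A) = emeasure \<mu> ((B \<inter> A) \<union> ((space \<mu> - B) \<inter> A))"
    using assms A by (intro plus_emeasure) auto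
  also have "(B \<inter> A) \<union> ((space \<mu> - B) \<inter> A) = A"
    using sets.sets_into_space[OF A] by auto
  finally show "emeasure (measure_plus (density \<mu> (indicator B)) (density \<mu> (indicator (space \<mu> - B)))) A = emeasure \<mu> A"
    using assms A by (simp add: emeasure_measure_plus emeasure_restricted)
qed simp

text \<open>Two points of the disc are less than \<open>2 * \<rho>\<close> apart, so the positive
  part of the logarithm is bounded. This excludes the value plus infinity for the potential of the
  part that is kept.\<close>

lemma nn_integral_ln_dist_ball_finite:
  assumes \<mu>: "fin_borel \<mu>" and z: "z \<in> ball z0 \<rho>"
  shows "(\<integral>\<^sup>+\<zeta>. ennreal (ln (cmod (z - \<zeta>))) \<partial>density \<mu> (indicator (ball z0 \<rho>))) < \<infinity>"
proof -
  interpret finite_measure \<mu> by (rule fin_borelD[OF \<mu>])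
  note [measurable_cong] = fin_borelD(2)[OF \<mu>]
  have le: "indicator (ball z0 \<rho>) \<zeta> * ennreal (ln (cmod (z - \<zeta>))) \<le> ennreal \<bar>ln (2 * \<rho>)\<bar>" for \<zeta>
  proof (cases "\<zeta> \<in> ball z0 \<rho> \<and> \<zeta> \<noteq> z")
    case True
    then have "cmod (z - \<zeta>) \<le> 2 * \<rho>"
      using z dist_triangle[of z \<zeta> z0] by (simp add: dist_norm norm_minus_commute)
    then have "ln (cmod (z - \<zeta>)) \<le> \<bar>ln (2 * \<rho>)\<bar>"
      using True by (smt (verit) ln_le_cancel_iff right_minus_eq zero_less_norm_iff)
    then show ?thesis
      using True by (simp add: ennreal_leI)
  qed auto
  have "(\<integral>\<^sup>+\<zeta>. ennreal (ln (cmod (z - \<zeta>))) \<partial>density \<mu> (indicator (ball z0 \<rho>)))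
      = (\<integral>\<^sup>+\<zeta>. indicator (ball z0 \<rho>) \<zeta> * ennreal (ln (cmod (z - \<zeta>))) \<partial>\<mu>)"
    using fin_borelD(2)[OF \<mu>] by (intro nn_integral_density borel_measurable_indicator) auto
  also have "\<dots> \<le> (\<integral>\<^sup>+\<zeta>. ennreal \<bar>ln (2 * \<rho>)\<bar> \<partial>\<mu>)"
    by (intro nn_integral_mono le)
  also have "\<dots> < \<infinity>"
    by (simp add: emeasure_eq_measure ennreal_mult_less_top)
  finally show ?thesis .
qed

lemma abs_ln_dist_bounded:
  assumes "0 < a" "\<And>w. w \<in> S \<Longrightarrow> a \<le> cmod (z - w)" "\<And>w. w \<in> S \<Longrightarrow> cmod (z - w) \<le> b" "w \<in> S"
  shows "\<bar>ln (cmod (z - w))\<bar> \<le> max (- ln a) (ln b)"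
  by (smt (verit) assms ln_le_cancel_iff)

text \<open>Off the disc the distance to \<open>z\<close> is at least
  \<open>\<rho> - dist z0 z\<close>, and on the compact set carrying \<open>\<mu>\<close> it is
  bounded above, so the logarithm is bounded almost everywhere there.\<close>

lemma integrable_ln_dist_outside:
  assumes \<mu>: "fin_borel \<mu>" and K: "compact K" "emeasure \<mu> (- K) = 0" and z: "z \<in> ball z0 \<rho>"
  shows "integrable \<mu> (\<lambda>\<zeta>. indicator (- ball z0 \<rho>) \<zeta> * ln (cmod (z - \<zeta>)))"
proof -
  interpret finite_measure \<mu> by (rule fin_borelD[OF \<mu>])
  note [measurable_cong] = fin_borelD(2)[OF \<mu>]
  obtain b where b: "\<And>\<zeta>. \<zeta> \<in> K \<Longrightarrow> cmod (z - \<zeta>) \<le> b"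
    using compact_imp_bounded[OF K(1)] bounded_any_center[of K z] by (auto simp: dist_norm)
  let ?b = "max (- ln (\<rho> - dist z0 z)) (ln b)"
  have le: "\<bar>ln (cmod (z - \<zeta>))\<bar> \<le> ?b" if "\<zeta> \<in> K - ball z0 \<rho>" for \<zeta>
  proof (rule abs_ln_dist_bounded[OF _ _ _ that])
    show "\<rho> - dist z0 z \<le> cmod (z - w)" if "w \<in> K - ball z0 \<rho>" for w
      using that dist_triangle[of z0 w z] by (simp add: dist_norm)
  qed (use b z in auto)
  have "- K \<in> sets borel"
    using K(1) by (simp add: borel_closed compact_imp_closed Compl_eq_Diff_UNIV)
  then have "- K \<in> null_sets \<mu>"
    using K(2) fin_borelD(2)[OF \<mu>] by auto
  then have "AE \<zeta> in \<mu>. \<zeta> \<in> K"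
    by (rule AE_I') auto
  \<comment> \<open>If \<open>K\<close> lies inside the disc, nothing forces \<open>?b\<close> to be
    nonnegative; its absolute value is also a bound where the indicator vanishes.\<close>
  moreover have "\<bar>ln (cmod (z - \<zeta>))\<bar> \<le> \<bar>?b\<bar>" if "\<zeta> \<in> K" "\<not> dist z0 \<zeta> < \<rho>" for \<zeta>
    using le[of \<zeta>] that by (intro order_trans[OF _ abs_ge_self]) auto
  ultimately show ?thesis
    by (intro integrable_const_bound[where B = "\<bar>?b\<bar>"])
      (auto elim!: eventually_mono simp: indicator_def)
qed

text \<open>The outer part contributes a real number, so a value of negative infinity at
  \<open>z\<close> comes entirely from the mass inside the disc.\<close>

lemma pot_split_ball:
  assumes \<mu>: "fin_borel \<mu>" and K: "compact K" "emeasure \<mu> (- K) = 0" and z: "z \<in> ball z0 \<rho>"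
  shows "pot \<mu> z = pot (density \<mu> (indicator (ball z0 \<rho>))) z +
    ereal (1 / (2 * pi) * (\<integral>\<zeta>. indicator (- ball z0 \<rho>) \<zeta> * ln (cmod (z - \<zeta>)) \<partial>\<mu>))"
proof -
  note [measurable_cong] = fin_borelD(2)[OF \<mu>]
  have closed: "- ball z0 \<rho> \<in> sets borel" by auto
  note [measurable] = closed
  have "integrable (density \<mu> (indicator (- ball z0 \<rho>))) (\<lambda>\<zeta>. ln (cmod (z - \<zeta>)))"
    using integrable_ln_dist_outside[OF \<mu> K z]
    unfolding density_indicator_real by (subst integrable_density) auto
  moreover have "AE \<zeta> in density \<mu> (indicator (- ball z0 \<rho>)). \<zeta> \<noteq> z"
    using z by (subst AE_density) (auto simp: indicator_def)
  ultimately have "pot (measure_plus (density \<mu> (indicator (ball z0 \<rho>))) (density \<mu> (indicator (- ball z0 \<rho>)))) z =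
      pot (density \<mu> (indicator (ball z0 \<rho>))) z +
      ereal (1 / (2 * pi) * (\<integral>\<zeta>. ln (cmod (z - \<zeta>)) \<partial>density \<mu> (indicator (- ball z0 \<rho>))))"
    using fin_borelD(2)[OF \<mu>] nn_integral_ln_dist_ball_finite[OF \<mu> z]
    by (intro pot_measure_plus) auto
  moreover have "measure_plus (density \<mu> (indicator (ball z0 \<rho>))) (density \<mu> (indicator (- ball z0 \<rho>))) = \<mu>"
    using measure_plus_restrict_Compl[of "ball z0 \<rho>" \<mu>] fin_borelD(2,3)[OF \<mu>]
    by (simp add: Compl_eq_Diff_UNIV)
  moreover have "(\<integral>\<zeta>. ln (cmod (z - \<zeta>)) \<partial>density \<mu> (indicator (- ball z0 \<rho>))) =
      (\<integral>\<zeta>. indicator (- ball z0 \<rho>) \<zeta> * ln (cmod (z - \<zeta>)) \<partial>\<mu>)"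
    unfolding density_indicator_real by (subst integral_density) auto
  ultimately show ?thesis
    by simp
qed

lemma integrable_ln_dist_mult_circle:
  fixes g :: "complex \<Rightarrow> real"
  assumes g: "g \<in> borel_measurable borel" "\<And>w. w \<in> sphere z0 r \<Longrightarrow> \<bar>g w\<bar> \<le> c"
    and r: "0 < r" and z: "z \<in> ball z0 r"
  shows "integrable (circle_measure z0 r) (\<lambda>w. ln (cmod (z - w)) * g w)"
proof -
  obtain b where b: "b \<ge> 0" "\<And>w. w \<in> sphere z0 r \<Longrightarrow> \<bar>ln (cmod (z - w))\<bar> \<le> b"
    using ln_dist_sphere_bound[OF z] by blast
  show ?thesis
  proof (rule integrable_circle_measure[where b = "b * c"])
    show "\<bar>ln (cmod (z - w)) * g w\<bar> \<le> b * c" if "w \<in> sphere z0 r" for w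
      unfolding abs_mult using b g(2) that by (intro mult_mono) auto
  qed (use r g(1) in auto)
qed

text \<open>\<open>ennreal\<close> truncates negative reals to 0, so the density of the circle
  measure is the positive part of \<open>g\<close>.\<close>

lemma pot_plus_circle_density:
  fixes g :: "complex \<Rightarrow> real"
  assumes \<mu>: "sets \<mu> = sets borel" "(\<integral>\<^sup>+\<zeta>. ennreal (ln (cmod (z - \<zeta>))) \<partial>\<mu>) < \<infinity>"
    and g: "g \<in> borel_measurable borel" "\<And>w. w \<in> sphere z0 r \<Longrightarrow> \<bar>g w\<bar> \<le> c"
    and r: "0 < r" and z: "z \<in> ball z0 r"
  shows "pot (measure_plus \<mu> (density (circle_measure z0 r) (\<lambda>w. ennreal (g w)))) z =
    pot \<mu> z + ereal (1 / (2 * pi) * (\<integral>w. ln (cmod (z - w)) * max 0 (g w) \<partial>circle_measure z0 r))"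
proof -
  let ?C = "circle_measure z0 r"
  note [measurable] = g(1)
  have eq: "density ?C (\<lambda>w. ennreal (g w)) = density ?C (\<lambda>w. ennreal (max 0 (g w)))"
    by (simp add: ennreal_max_0)
  have "integrable ?C (\<lambda>w. ln (cmod (z - w)) * max 0 (g w))"
    using g r z by (intro integrable_ln_dist_mult_circle[where c = c]) force+
  then have "integrable (density ?C (\<lambda>w. ennreal (g w))) (\<lambda>w. ln (cmod (z - w)))"
    unfolding eq by (subst integrable_density) (auto simp: mult.commute)
  moreover have "AE w in density ?C (\<lambda>w. ennreal (g w)). w \<noteq> z"
    using AE_circle_measure[of r z0] r z by (subst AE_density) (auto elim!: eventually_mono)
  ultimately have "pot (measure_plus \<mu> (density ?C (\<lambda>w. ennreal (g w)))) z =
      pot \<mu> z + ereal (1 / (2 * pi) * (\<integral>w. ln (cmod (z - w)) \<partial>density ?C (\<lambda>w. ennreal (g w))))"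
    using \<mu> by (intro pot_measure_plus) auto
  also have "(\<integral>w. ln (cmod (z - w)) \<partial>density ?C (\<lambda>w. ennreal (g w))) =
      (\<integral>w. ln (cmod (z - w)) * max 0 (g w) \<partial>?C)"
    unfolding eq by (subst integral_density) (auto simp: mult.commute)
  finally show ?thesis .
qed

section \<open>Localization\<close>

text \<open>Used with \<open>g\<close> for the positive and with \<open>- g\<close> for the negative
  part of \<omega>: through the truncation by \<open>ennreal\<close>, one signed density on the
  circle is split into its positive and negative parts.\<close>

definition localized :: "complex \<Rightarrow> real \<Rightarrow> real \<Rightarrow> complex measure \<Rightarrow> (complex \<Rightarrow> real) \<Rightarrow> complex measure" where
  "localized z0 r \<rho> \<mu> g = measure_plus (density \<mu> (indicator (ball z0 \<rho>)))
     (density (circle_measure z0 r) (\<lambda>w. ennreal (g w)))"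

lemma sets_localized: "fin_borel \<mu> \<Longrightarrow> sets (localized z0 r \<rho> \<mu> g) = sets borel"
  using fin_borelD(2)[of \<mu>] by (simp add: localized_def)

lemma emeasure_localized:
  assumes "fin_borel \<mu>" "A \<in> sets borel"
  shows "emeasure (localized z0 r \<rho> \<mu> g) A =
    emeasure \<mu> (ball z0 \<rho> \<inter> A) + emeasure (density (circle_measure z0 r) (\<lambda>w. ennreal (g w))) A"
  using assms fin_borelD(2)[OF assms(1)]
  by (simp add: localized_def emeasure_measure_plus emeasure_restricted)

lemma emeasure_circle_density_eq_0:
  fixes g :: "complex \<Rightarrow> real"
  assumes "0 \<le> r" and [measurable]: "A \<in> sets borel" "g \<in> borel_measurable borel"
    and "\<And>w. w \<in> A \<Longrightarrow> w \<in> sphere z0 r \<Longrightarrow> g w \<le> 0"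
  shows "emeasure (density (circle_measure z0 r) (\<lambda>w. ennreal (g w))) A = 0"
proof -
  have "AE w in circle_measure z0 r. ennreal (g w) * indicator A w = 0"
    using AE_circle_measure[OF assms(1), of z0] assms(4)
    by (auto elim!: eventually_mono simp: indicator_def ennreal_neg)
  then show ?thesis
    by (simp add: emeasure_density nn_integral_0_iff_AE)
qed

text \<open>At each point at most one of \<open>g w\<close> and \<open>- g w\<close> survives
  truncation, so the two densities add up to the absolute value of \<open>g\<close>, and the circle
  has total mass 1.\<close>

lemma emeasure_circle_density_le:
  fixes g :: "complex \<Rightarrow> real"
  assumes "0 \<le> r" and [measurable]: "A \<in> sets borel" "g \<in> borel_measurable borel"
    and "\<And>w. w \<in> sphere z0 r \<Longrightarrow> \<bar>g w\<bar> \<le> b"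
  shows "emeasure (density (circle_measure z0 r) (\<lambda>w. ennreal (g w))) A +
    emeasure (density (circle_measure z0 r) (\<lambda>w. ennreal (- g w))) A \<le> ennreal b"
proof -
  let ?C = "circle_measure z0 r"
  have "emeasure (density ?C (\<lambda>w. ennreal (g w))) A + emeasure (density ?C (\<lambda>w. ennreal (- g w))) A
      = (\<integral>\<^sup>+w. ennreal (g w) * indicator A w + ennreal (- g w) * indicator A w \<partial>?C)"
    by (simp add: emeasure_density nn_integral_add)
  also have "\<dots> \<le> (\<integral>\<^sup>+w. ennreal b \<partial>?C)"
  proof (rule nn_integral_mono_AE)
    have "ennreal x * indicator A w + ennreal (- x) * indicator A w \<le> ennreal b" if "\<bar>x\<bar> \<le> b" for x w
      using that by (cases "x \<ge> 0") (auto simp: indicator_def ennreal_neg intro!: ennreal_leI)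
    then show "AE w in ?C. ennreal (g w) * indicator A w + ennreal (- g w) * indicator A w \<le> ennreal b"
      using AE_circle_measure[OF assms(1), of z0] assms(4) by (auto elim!: eventually_mono)
  qed
  also have "\<dots> = ennreal b"
    by simp
  finally show ?thesis .
qed

lemma fin_borel_localized:
  assumes "fin_borel \<mu>" "0 \<le> r" "g \<in> borel_measurable borel" "\<And>w. w \<in> sphere z0 r \<Longrightarrow> \<bar>g w\<bar> \<le> b"
  shows "fin_borel (localized z0 r \<rho> \<mu> g)"
proof -
  interpret finite_measure \<mu> by (rule fin_borelD[OF assms(1)])
  have "space (localized z0 r \<rho> \<mu> g) = UNIV"
    using sets_eq_imp_space_eq[OF sets_localized[OF assms(1)]] by simp
  moreover have "emeasure (density (circle_measure z0 r) (\<lambda>w. ennreal (g w))) UNIV \<le> ennreal b"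
    using emeasure_circle_density_le[OF assms(2) _ assms(3,4), of UNIV]
    by (rule order_trans[rotated]) auto
  then have "emeasure (density (circle_measure z0 r) (\<lambda>w. ennreal (g w))) UNIV < top"
    using ennreal_less_top order_le_less_trans by blast
  moreover have "emeasure \<mu> (ball z0 \<rho>) < top"
    by (simp add: emeasure_eq_measure)
  ultimately show ?thesis
    using sets_localized[OF assms(1)] emeasure_localized[OF assms(1), of UNIV]
    by (simp add: fin_borel_def)
qed

lemma jordan_pair_localized:
  assumes \<omega>: "jordan_pair \<omega>p \<omega>n" and r: "0 \<le> r"
    and g: "g \<in> borel_measurable borel" "\<And>w. w \<in> sphere z0 r \<Longrightarrow> \<bar>g w\<bar> \<le> b"
    and null: "emeasure \<omega>p (sphere z0 r) = 0" "emeasure \<omega>n (sphere z0 r) = 0"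
  shows "jordan_pair (localized z0 r \<rho> \<omega>p g) (localized z0 r \<rho> \<omega>n (\<lambda>w. - g w))"
proof -
  obtain P where fin: "fin_borel \<omega>p" "fin_borel \<omega>n"
    and P: "P \<in> sets borel" "emeasure \<omega>p (- P) = 0" "emeasure \<omega>n P = 0"
    using \<omega> by (auto simp: jordan_pair_def)
  note s = fin_borelD(2)[OF fin(1)] fin_borelD(2)[OF fin(2)]
  note [measurable] = g(1) P(1)
  \<comment> \<open>A Hahn set for the new pair: \<open>P\<close> decides off the circle, the sign
    of \<open>g\<close> decides on it. Replacing \<open>P\<close> on the circle is harmless because
    neither part of \<omega> charges it.\<close>
  define Q where "Q = (P - sphere z0 r) \<union> (sphere z0 r \<inter> {w. g w > 0})"
  have sph: "sphere z0 r \<in> sets borel" by auto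
  have Q: "Q \<in> sets borel"
    unfolding Q_def using sph by measurable
  have "emeasure \<omega>p (ball z0 \<rho> \<inter> - Q) \<le> emeasure \<omega>p (- P \<union> sphere z0 r)"
    using s sph by (intro emeasure_mono) (auto simp: Q_def)
  also have "\<dots> \<le> emeasure \<omega>p (- P) + emeasure \<omega>p (sphere z0 r)"
    using s sph by (intro emeasure_subadditive) auto
  finally have 1: "emeasure \<omega>p (ball z0 \<rho> \<inter> - Q) = 0"
    using P null by simp
  have "emeasure \<omega>n (ball z0 \<rho> \<inter> Q) \<le> emeasure \<omega>n (P \<union> sphere z0 r)"
    using s sph by (intro emeasure_mono) (auto simp: Q_def)
  also have "\<dots> \<le> emeasure \<omega>n P + emeasure \<omega>n (sphere z0 r)"
    using s sph by (intro emeasure_subadditive) auto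
  finally have 2: "emeasure \<omega>n (ball z0 \<rho> \<inter> Q) = 0"
    using P null by simp
  have 3: "emeasure (density (circle_measure z0 r) (\<lambda>w. ennreal (g w))) (- Q) = 0"
    "emeasure (density (circle_measure z0 r) (\<lambda>w. ennreal (- g w))) Q = 0"
    using r Q g(1) by (auto intro!: emeasure_circle_density_eq_0 simp: Q_def)
  show ?thesis
    unfolding jordan_pair_def
  proof (intro conjI bexI[of _ Q])
    show "fin_borel (localized z0 r \<rho> \<omega>p g)" "fin_borel (localized z0 r \<rho> \<omega>n (\<lambda>w. - g w))"
      using fin r g by (auto intro!: fin_borel_localized[where b = b])
    show "emeasure (localized z0 r \<rho> \<omega>p g) (- Q) = 0"
      using 1 3 Q by (simp add: emeasure_localized fin)
    show "emeasure (localized z0 r \<rho> \<omega>n (\<lambda>w. - g w)) Q = 0"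
      using 2 3 Q by (simp add: emeasure_localized fin)
  qed (rule Q)
qed

lemma measure_localized_disjoint_sphere:
  assumes "fin_borel \<mu>" "0 \<le> r" "g \<in> borel_measurable borel" "A \<in> sets borel" "A \<inter> sphere z0 r = {}"
  shows "measure (localized z0 r \<rho> \<mu> g) A = measure \<mu> (ball z0 \<rho> \<inter> A)"
proof -
  have "emeasure (density (circle_measure z0 r) (\<lambda>w. ennreal (g w))) A = 0"
    using assms by (intro emeasure_circle_density_eq_0) auto
  then show ?thesis
    using emeasure_localized[OF assms(1,4)] by (simp add: measure_def)
qed

lemma measure_localized_le:
  assumes \<omega>: "fin_borel \<omega>p" "fin_borel \<omega>n" and r: "0 \<le> r"
    and g: "g \<in> borel_measurable borel" "\<And>w. w \<in> sphere z0 r \<Longrightarrow> \<bar>g w\<bar> \<le> b"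
    and A: "A \<in> sets borel" and b: "0 \<le> b"
  shows "measure (localized z0 r \<rho> \<omega>p g) A + measure (localized z0 r \<rho> \<omega>n (\<lambda>w. - g w)) A
    \<le> measure \<omega>p (ball z0 \<rho> \<inter> A) + measure \<omega>n (ball z0 \<rho> \<inter> A) + b"
proof -
  interpret p: finite_measure \<omega>p by (rule fin_borelD[OF \<omega>(1)])
  interpret n: finite_measure \<omega>n by (rule fin_borelD[OF \<omega>(2)])
  interpret lp: finite_measure "localized z0 r \<rho> \<omega>p g"
    using fin_borel_localized[OF \<omega>(1) r g] by (rule fin_borelD)
  interpret ln: finite_measure "localized z0 r \<rho> \<omega>n (\<lambda>w. - g w)"
    using fin_borel_localized[OF \<omega>(2) r, of "\<lambda>w. - g w" z0 b] g by (intro fin_borelD) auto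
  have "ennreal (measure (localized z0 r \<rho> \<omega>p g) A + measure (localized z0 r \<rho> \<omega>n (\<lambda>w. - g w)) A) =
      emeasure (localized z0 r \<rho> \<omega>p g) A + emeasure (localized z0 r \<rho> \<omega>n (\<lambda>w. - g w)) A"
    by (simp add: lp.emeasure_eq_measure ln.emeasure_eq_measure)
  also have "\<dots> = emeasure \<omega>p (ball z0 \<rho> \<inter> A) + emeasure \<omega>n (ball z0 \<rho> \<inter> A) +
     (emeasure (density (circle_measure z0 r) (\<lambda>w. ennreal (g w))) A +
      emeasure (density (circle_measure z0 r) (\<lambda>w. ennreal (- g w))) A)"
    by (simp add: emeasure_localized \<omega> A add_ac)
  also have "\<dots> \<le> emeasure \<omega>p (ball z0 \<rho> \<inter> A) + emeasure \<omega>n (ball z0 \<rho> \<inter> A) + ennreal b"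
    using r A g by (intro add_left_mono emeasure_circle_density_le) auto
  also have "\<dots> = ennreal (measure \<omega>p (ball z0 \<rho> \<inter> A) + measure \<omega>n (ball z0 \<rho> \<inter> A) + b)"
    using b by (simp add: p.emeasure_eq_measure n.emeasure_eq_measure)
  finally show ?thesis
    by (rule ennreal_le_iff[THEN iffD1, rotated]) (simp add: b)
qed

section \<open>The density that generates the harmonic remainder\<close>

text \<open>This is \<open>- 4 * pi\<close> times \<open>r\<close> times the radial derivative of
  the harmonic remainder, where \<open>r\<close> is the distance from \<open>w\<close> to
  \<open>z0\<close>. The \<open>swept\<close> terms carry only \<open>- 2\<close> since potentials
  contain the factor \<open>1 / (2 * pi)\<close>. Per unit length the density is \<open>-2\<close>
  times the normal derivative.\<close>

definition sweep_density ::
  "complex measure \<Rightarrow> complex measure \<Rightarrow> complex \<Rightarrow> real \<Rightarrow> (complex \<Rightarrow> complex) \<Rightarrow> complex \<Rightarrow> real" where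
  "sweep_density \<omega>p \<omega>n z0 \<rho> F' w =
     - 2 * (swept \<omega>p z0 \<rho> w - swept \<omega>n z0 \<rho> w) - 4 * pi * Re ((w - z0) * F' w)"

lemma sweep_density_measurable:
  assumes "fin_borel \<omega>p" "fin_borel \<omega>n" "F' \<in> borel_measurable borel"
  shows "sweep_density \<omega>p \<omega>n z0 \<rho> F' \<in> borel_measurable borel"
  unfolding sweep_density_def[abs_def]
  using assms swept_measurable[OF assms(1)] swept_measurable[OF assms(2)] by measurable

lemma sweep_density_bound:
  assumes "fin_borel \<omega>p" "fin_borel \<omega>n" "0 < r" "r < \<rho>" "r < s" "w \<in> sphere z0 r" "cmod (F' w) \<le> c"
  shows "\<bar>sweep_density \<omega>p \<omega>n z0 \<rho> F' w\<bar> \<le>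
    2 * (r / (\<rho> - r)) * (measure \<omega>p (ball z0 s - {z0}) + measure \<omega>n (ball z0 s - {z0})) +
    2 * (r / (s - r)) * (measure \<omega>p UNIV + measure \<omega>n UNIV) + 4 * pi * r * c"
proof -
  have "\<bar>Re ((w - z0) * F' w)\<bar> \<le> cmod (w - z0) * cmod (F' w)"
    using abs_Re_le_cmod[of "(w - z0) * F' w"] by (simp add: norm_mult)
  also have "\<dots> \<le> r * c"
    using assms by (intro mult_mono) (auto simp: dist_norm norm_minus_commute)
  finally have "\<bar>4 * pi * Re ((w - z0) * F' w)\<bar> \<le> 4 * pi * r * c"
    by (simp add: abs_mult)
  moreover have "\<bar>swept \<omega>p z0 \<rho> w\<bar> \<le> r / (\<rho> - r) * measure \<omega>p (ball z0 s - {z0}) + r / (s - r) * measure \<omega>p UNIV"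
    "\<bar>swept \<omega>n z0 \<rho> w\<bar> \<le> r / (\<rho> - r) * measure \<omega>n (ball z0 s - {z0}) + r / (s - r) * measure \<omega>n UNIV"
    using assms by (intro swept_bound; simp)+
  moreover have "\<bar>- 2 * (x - y) - d\<bar> \<le> 2 * \<bar>x\<bar> + 2 * \<bar>y\<bar> + \<bar>d\<bar>" for x y d :: real
    by (simp add: abs_if)
  from this[of "swept \<omega>p z0 \<rho> w" "swept \<omega>n z0 \<rho> w" "4 * pi * Re ((w - z0) * F' w)"]
  have "\<bar>sweep_density \<omega>p \<omega>n z0 \<rho> F' w\<bar> \<le>
      2 * \<bar>swept \<omega>p z0 \<rho> w\<bar> + 2 * \<bar>swept \<omega>n z0 \<rho> w\<bar> + \<bar>4 * pi * Re ((w - z0) * F' w)\<bar>"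
    by (simp only: sweep_density_def)
  ultimately show ?thesis
    unfolding distrib_left mult.assoc by linarith
qed

text \<open>Both sides contain the same potentials of the mass inside the disc. What remains is
  real: the circle potential supplies the increment of the harmonic remainder from \<open>z0\<close>
  to \<open>z\<close>, and the added constant is its value at \<open>z0\<close>.\<close>

lemma pot_localized_sweep_density:
  assumes \<omega>: "fin_borel \<omega>p" "fin_borel \<omega>n"
    and K: "compact K" "emeasure \<omega>p (- K) = 0" "emeasure \<omega>n (- K) = 0"
    and F: "\<And>w. w \<in> ball z0 \<rho> \<Longrightarrow> (F has_field_derivative F' w) (at w)"
    and F': "F' \<in> borel_measurable borel" "\<And>w. w \<in> sphere z0 r \<Longrightarrow> cmod (F' w) \<le> c"
    and r: "0 < r" "r < \<rho>" and z: "z \<in> ball z0 r"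
  shows "pot \<omega>p z - pot \<omega>n z + ereal (Re (F z)) =
    pot (localized z0 r \<rho> \<omega>p (sweep_density \<omega>p \<omega>n z0 \<rho> F')) z -
    pot (localized z0 r \<rho> \<omega>n (\<lambda>w. - sweep_density \<omega>p \<omega>n z0 \<rho> F' w)) z +
    ereal (Re (F z0) + 1 / (2 * pi) *
      ((\<integral>\<zeta>. indicator (- ball z0 \<rho>) \<zeta> * ln (cmod (z0 - \<zeta>)) \<partial>\<omega>p) -
       (\<integral>\<zeta>. indicator (- ball z0 \<rho>) \<zeta> * ln (cmod (z0 - \<zeta>)) \<partial>\<omega>n)))"
proof -
  let ?C = "circle_measure z0 r"
  define g where "g = sweep_density \<omega>p \<omega>n z0 \<rho> F'"
  define L where "L \<mu> y = (\<integral>\<zeta>. indicator (- ball z0 \<rho>) \<zeta> * ln (cmod (y - \<zeta>)) \<partial>\<mu>)" for \<mu> y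
  have z\<rho>: "z \<in> ball z0 \<rho>" and z0\<rho>: "z0 \<in> ball z0 \<rho>"
    using z r by auto
  have g: "g \<in> borel_measurable borel"
    unfolding g_def by (rule sweep_density_measurable[OF \<omega> F'(1)])
  \<comment> \<open>Any finite bound will do for integrability, so the auxiliary radius
    \<open>r + 1\<close> is arbitrary.\<close>
  obtain b where b: "\<And>w. w \<in> sphere z0 r \<Longrightarrow> \<bar>g w\<bar> \<le> b"
  proof
    show "\<bar>g w\<bar> \<le> 2 * (r / (\<rho> - r)) * (measure \<omega>p (ball z0 (r + 1) - {z0}) + measure \<omega>n (ball z0 (r + 1) - {z0})) +
        2 * (r / (r + 1 - r)) * (measure \<omega>p UNIV + measure \<omega>n UNIV) + 4 * pi * r * c"
      if "w \<in> sphere z0 r" for w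
      unfolding g_def using F'(2)[OF that] by (intro sweep_density_bound \<omega> r that) auto
  qed
  have L_diff: "(\<integral>w. ln (cmod (z - w)) * swept \<mu> z0 \<rho> w \<partial>?C) = - (L \<mu> z - L \<mu> z0) / 2"
    if "fin_borel \<mu>" "emeasure \<mu> (- K) = 0" for \<mu>
    unfolding integral_ln_dist_swept[OF that(1) r z] L_def
    using integrable_ln_dist_outside[OF that(1) K(1) that(2)] z\<rho> z0\<rho>
    by (simp add: right_diff_distrib)
  have int_swept: "integrable ?C (\<lambda>w. ln (cmod (z - w)) * swept \<mu> z0 \<rho> w)" if "fin_borel \<mu>" for \<mu>
    using swept_bound[OF that r, of "r + 1"] swept_measurable[OF that] r z
    by (intro integrable_ln_dist_mult_circle[where
          c = "r / (\<rho> - r) * measure \<mu> (ball z0 (r + 1) - {z0}) + r / (r + 1 - r) * measure \<mu> UNIV"]) auto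
  have int_F: "integrable ?C (\<lambda>w. ln (cmod (z - w)) * Re ((w - z0) * F' w))"
  proof (rule integrable_ln_dist_mult_circle)
    show "\<bar>Re ((w - z0) * F' w)\<bar> \<le> r * c" if "w \<in> sphere z0 r" for w
    proof -
      have "\<bar>Re ((w - z0) * F' w)\<bar> \<le> cmod (w - z0) * cmod (F' w)"
        using abs_Re_le_cmod[of "(w - z0) * F' w"] by (simp add: norm_mult)
      also have "\<dots> \<le> r * c"
        using that F' r by (intro mult_mono) (auto simp: dist_norm norm_minus_commute)
      finally show ?thesis .
    qed
  qed (use F' r z in auto)
  have "(\<integral>w. ln (cmod (z - w)) * g w \<partial>?C) =
      (\<integral>w. - 2 * (ln (cmod (z - w)) * swept \<omega>p z0 \<rho> w - ln (cmod (z - w)) * swept \<omega>n z0 \<rho> w)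
         - 4 * pi * (ln (cmod (z - w)) * Re ((w - z0) * F' w)) \<partial>?C)"
    by (intro Bochner_Integration.integral_cong) (auto simp: g_def sweep_density_def algebra_simps)
  also have "\<dots> = - 2 * ((\<integral>w. ln (cmod (z - w)) * swept \<omega>p z0 \<rho> w \<partial>?C) - (\<integral>w. ln (cmod (z - w)) * swept \<omega>n z0 \<rho> w \<partial>?C))
      - 4 * pi * (\<integral>w. ln (cmod (z - w)) * Re ((w - z0) * F' w) \<partial>?C)"
    using int_swept \<omega> int_F by simp
  also have "(\<integral>w. ln (cmod (z - w)) * Re ((w - z0) * F' w) \<partial>?C) = - (Re (F z) - Re (F z0)) / 2"
    by (rule integral_ln_dist_circle_measure[OF F F'(1) r z])
  \<comment> \<open>The circle integral becomes \<open>2 * pi\<close> times the increment of the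
    harmonic remainder.\<close>
  also have "- 2 * ((\<integral>w. ln (cmod (z - w)) * swept \<omega>p z0 \<rho> w \<partial>?C) - (\<integral>w. ln (cmod (z - w)) * swept \<omega>n z0 \<rho> w \<partial>?C))
      - 4 * pi * (- (Re (F z) - Re (F z0)) / 2) = (L \<omega>p z - L \<omega>p z0) - (L \<omega>n z - L \<omega>n z0) + 2 * pi * (Re (F z) - Re (F z0))"
    unfolding L_diff[OF \<omega>(1) K(2)] L_diff[OF \<omega>(2) K(3)]
    by (simp add: field_simps)
  finally have total: "(\<integral>w. ln (cmod (z - w)) * g w \<partial>?C) = \<dots>" .
  have int_max: "integrable ?C (\<lambda>w. ln (cmod (z - w)) * max 0 (g w))"
    "integrable ?C (\<lambda>w. ln (cmod (z - w)) * max 0 (- g w))"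
    using g b r z by (intro integrable_ln_dist_mult_circle[where c = b]; force)+
  define Ip where "Ip = (\<integral>w. ln (cmod (z - w)) * max 0 (g w) \<partial>?C)"
  define In where "In = (\<integral>w. ln (cmod (z - w)) * max 0 (- g w) \<partial>?C)"
  have "Ip - In = (\<integral>w. ln (cmod (z - w)) * max 0 (g w) - ln (cmod (z - w)) * max 0 (- g w) \<partial>?C)"
    unfolding Ip_def In_def using int_max by simp
  also have "\<dots> = (\<integral>w. ln (cmod (z - w)) * g w \<partial>?C)"
    by (intro Bochner_Integration.integral_cong) (auto simp: max_def)
  finally have I: "Ip - In = (L \<omega>p z - L \<omega>p z0) - (L \<omega>n z - L \<omega>n z0) + 2 * pi * (Re (F z) - Re (F z0))"
    unfolding total .
  have real_eq: "1 / (2 * pi) * L \<omega>p z - 1 / (2 * pi) * L \<omega>n z + Re (F z) =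
      1 / (2 * pi) * Ip - 1 / (2 * pi) * In + (Re (F z0) + 1 / (2 * pi) * (L \<omega>p z0 - L \<omega>n z0))"
  proof -
    have "1 / (2 * pi) * (Ip - In) =
        1 / (2 * pi) * ((L \<omega>p z - L \<omega>p z0) - (L \<omega>n z - L \<omega>n z0)) + (Re (F z) - Re (F z0))"
      unfolding I distrib_left by simp
    then show ?thesis
      unfolding right_diff_distrib by linarith
  qed
  \<comment> \<open>The summands \<open>x\<close> and \<open>y\<close>, the potentials of the inner
    mass, may be infinite; they stay in place and only the real summands are balanced.\<close>
  have ereal_eq: "x + ereal a - (y + ereal a') + ereal d = x + ereal e - (y + ereal e') + ereal d'"
    if "a - a' + d = e - e' + d'" for x y a a' d e e' d'
    using that by (cases x; cases y) auto
  have sets: "sets (density \<mu> (indicator (ball z0 \<rho>))) = sets borel" if "fin_borel \<mu>" for \<mu>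
    using fin_borelD(2)[OF that] by simp
  have "pot (localized z0 r \<rho> \<omega>p g) z = pot (density \<omega>p (indicator (ball z0 \<rho>))) z + ereal (1 / (2 * pi) * Ip)"
    unfolding localized_def Ip_def
    by (rule pot_plus_circle_density[OF sets[OF \<omega>(1)] nn_integral_ln_dist_ball_finite[OF \<omega>(1) z\<rho>] g b r(1) z])
  moreover have "pot (localized z0 r \<rho> \<omega>n (\<lambda>w. - g w)) z =
      pot (density \<omega>n (indicator (ball z0 \<rho>))) z + ereal (1 / (2 * pi) * In)"
    unfolding localized_def In_def using g b
    by (intro pot_plus_circle_density[OF sets[OF \<omega>(2)] nn_integral_ln_dist_ball_finite[OF \<omega>(2) z\<rho>] _ _ r(1) z]) auto
  ultimately show ?thesis
    unfolding g_def[symmetric] L_def[symmetric]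
      pot_split_ball[OF \<omega>(1) K(1,2) z\<rho>, folded L_def] pot_split_ball[OF \<omega>(2) K(1,3) z\<rho>, folded L_def]
    using ereal_eq[OF real_eq] by simp
qed

section \<open>Choice of the radii\<close>

text \<open>Continuity from above: removing \<open>z0\<close> makes the intersection of the
  shrinking discs empty, even if \<open>\<mu>\<close> has an atom there.\<close>

lemma small_punctured_ball:
  assumes "fin_borel \<mu>" "0 < e"
  obtains s where "0 < s" "measure \<mu> (ball z0 s - {z0}) < e"
proof -
  interpret finite_measure \<mu> by (rule fin_borelD[OF assms(1)])
  define A where "A n = ball z0 (1 / real (Suc n)) - {z0}" for n
  have "(\<lambda>n. measure \<mu> (A n)) \<longlonglongrightarrow> measure \<mu> (\<Inter>n. A n)"
  proof (rule finite_Lim_measure_decseq)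
    show "range A \<subseteq> sets \<mu>"
      unfolding A_def fin_borelD(2)[OF assms(1)] by auto
    show "decseq A"
      unfolding decseq_def
    proof (intro allI impI)
      fix m n :: nat assume "m \<le> n"
      then have "1 / real (Suc n) \<le> 1 / real (Suc m)"
        by (intro divide_left_mono) auto
      then show "A n \<subseteq> A m"
        unfolding A_def by (intro Diff_mono subset_ball) auto
    qed
  qed
  moreover have "(\<Inter>n. A n) = {}"
  proof (rule ccontr)
    assume "(\<Inter>n. A n) \<noteq> {}"
    then obtain w where "w \<in> (\<Inter>n. A n)" by blast
    then have w: "w \<in> A n" for n by blast
    have "0 < dist z0 w"
      using w[of 0] by (auto simp: A_def)
    then obtain n where "1 / real (Suc n) < dist z0 w"
      by (rule nat_approx_posE)
    then show False
      using w[of n] by (simp add: A_def)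
  qed
  ultimately have "(\<lambda>n. measure \<mu> (A n)) \<longlonglongrightarrow> 0"
    by simp
  then have "\<forall>\<^sub>F n in sequentially. measure \<mu> (A n) < e"
    using assms(2) by (rule order_tendstoD(2))
  then have "\<exists>n. measure \<mu> (A n) < e"
    by (rule eventually_happens'[OF sequentially_bot])
  then obtain n where "measure \<mu> (A n) < e" ..
  then show ?thesis
    unfolding A_def by (rule that[rotated]) simp
qed

text \<open>Spheres around \<open>z0\<close> of positive mass are atoms of the image of
  \<open>\<mu>\<close> under the distance from \<open>z0\<close>, and a finite measure has countably
  many atoms.\<close>

lemma countable_charged_spheres:
  assumes "fin_borel \<mu>"
  shows "countable {r. emeasure \<mu> (sphere z0 r) \<noteq> 0}"
proof -
  interpret finite_measure \<mu> by (rule fin_borelD[OF assms])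
  note [measurable_cong] = fin_borelD(2)[OF assms]
  have [measurable]: "dist z0 \<in> borel_measurable \<mu>"
    by measurable
  interpret d: finite_measure "distr \<mu> borel (dist z0)"
    by (rule finite_measure_distr) measurable
  have "measure (distr \<mu> borel (dist z0)) {r} = measure \<mu> (sphere z0 r)" for r
  proof -
    have "dist z0 -` {r} \<inter> space \<mu> = sphere z0 r"
      using fin_borelD(3)[OF assms] by auto
    then show ?thesis
      by (subst measure_distr) auto
  qed
  then have "{r. emeasure \<mu> (sphere z0 r) \<noteq> 0} = {r. measure (distr \<mu> borel (dist z0)) {r} \<noteq> 0}"
    by (simp only: emeasure_eq_measure ennreal_eq_0_iff measure_le_0_iff)
  then show ?thesis
    using d.countable_support by (simp only:)
qed

theorem theorem3p31:
  fixes M :: "complex set" and h :: "complex \<Rightarrow> real"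
    and \<omega>p \<omega>n :: "complex measure" and z0 :: complex and \<epsilon> \<eta> :: real
  assumes "open M" "connected M" "M \<noteq> {}"
    and "harmonic_on h M"
    and "jordan_pair \<omega>p \<omega>n" "compact_supp \<omega>p \<omega>n"
    and "z0 \<in> M" and "\<epsilon> > 0" and "\<eta> > 0"
  shows "\<exists>\<delta> k (\<tau>p :: complex measure) \<tau>n. \<delta> > 0 \<and> cball z0 (\<delta> * (1 + \<eta>)) \<subseteq> M \<and>
     jordan_pair \<tau>p \<tau>n \<and>
     (\<forall>A\<in>sets borel. A \<subseteq> ball z0 \<delta> \<longrightarrow>
        measure \<tau>p A - measure \<tau>n A = measure \<omega>p A - measure \<omega>n A) \<and>
     (\<forall>A\<in>sets borel. A \<inter> ball z0 (\<delta> * (1 + \<eta>)) = {} \<longrightarrow>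
        measure \<tau>p A - measure \<tau>n A = 0) \<and>
     measure \<tau>p (ball z0 (\<delta> * (1 + \<eta>)) - {z0}) + measure \<tau>n (ball z0 (\<delta> * (1 + \<eta>)) - {z0}) < \<epsilon> \<and>
     (\<forall>z\<in>ball z0 \<delta>. pot_defined \<omega>p \<omega>n z \<and> pot_defined \<tau>p \<tau>n z \<longrightarrow>
        pot_h \<omega>p \<omega>n h z = pot \<tau>p z - pot \<tau>n z + ereal k)"
proof -
  have fin: "fin_borel \<omega>p" "fin_borel \<omega>n"
    using assms(5) by (auto simp: jordan_pair_def)
  note s_borel = fin_borelD(2)[OF fin(1)] fin_borelD(2)[OF fin(2)]
  interpret p: finite_measure \<omega>p by (rule fin_borelD[OF fin(1)])
  interpret n: finite_measure \<omega>n by (rule fin_borelD[OF fin(2)])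
  obtain K where K: "compact K" "emeasure \<omega>p (- K) = 0" "emeasure \<omega>n (- K) = 0"
    using assms(6) by (auto simp: compact_supp_def)
  obtain R where R: "0 < R" "ball z0 R \<subseteq> M"
    using \<open>open M\<close> \<open>z0 \<in> M\<close> open_contains_ball by blast
  obtain F f where F: "\<And>w. w \<in> ball z0 R \<Longrightarrow> (F has_field_derivative f w) (at w)"
    and hF: "\<And>w. w \<in> ball z0 R \<Longrightarrow> h w = Re (F w)"
    by (rule harmonic_on_ball_eq_Re[OF assms(4) R(2)]) (rule that)
  have cont_f: "continuous_on (ball z0 R) f"
    by (rule continuous_on_field_derivative[OF open_ball F])
  \<comment> \<open>Extending \<open>f\<close> by 0 gives a Borel function on the whole plane, as
    integration against measures on the plane requires.\<close>
  define F' where "F' w = indicator (ball z0 R) w *\<^sub>R f w" for w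
  have F'_meas: "F' \<in> borel_measurable borel"
    unfolding F'_def using cont_f by (intro borel_measurable_continuous_on_indicator) auto
  have F'_deriv: "(F has_field_derivative F' w) (at w)" if "w \<in> ball z0 R" for w
    using F[OF that] that by (simp add: F'_def)
  have "bounded (f ` cball z0 (R / 2))"
    using R by (intro compact_imp_bounded compact_continuous_image continuous_on_subset[OF cont_f]) auto
  then obtain c where c: "0 < c" "\<And>w. w \<in> cball z0 (R / 2) \<Longrightarrow> cmod (f w) \<le> c"
    by (auto simp: bounded_pos)
  define \<kappa> where "\<kappa> = (2 + \<eta>) / \<eta>"
  have \<kappa>: "\<kappa> > 0" using \<open>\<eta> > 0\<close> by (simp add: \<kappa>_def)
  \<comment> \<open>The mass near \<open>z0\<close>, at most \<open>m < 2 * e\<close>, enters once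
    as kept mass and \<open>2 * \<kappa>\<close> times through the circle density. So
    \<open>e\<close> makes this share less than \<open>\<epsilon> / 2\<close>.\<close>
  define e where "e = \<epsilon> / (4 * (1 + 2 * \<kappa>))"
  have e: "e > 0" using \<open>\<epsilon> > 0\<close> \<kappa> by (simp add: e_def)
  obtain sp where sp: "0 < sp" "measure \<omega>p (ball z0 sp - {z0}) < e"
    by (rule small_punctured_ball[OF fin(1) e])
  obtain sn where sn: "0 < sn" "measure \<omega>n (ball z0 sn - {z0}) < e"
    by (rule small_punctured_ball[OF fin(2) e])
  define s where "s = min sp sn"
  define m where "m = measure \<omega>p (ball z0 s - {z0}) + measure \<omega>n (ball z0 s - {z0})"
  have s: "s > 0" using sp sn by (simp add: s_def)
  have m: "m < 2 * e" "m \<ge> 0"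
  proof -
    have "measure \<omega>p (ball z0 s - {z0}) \<le> measure \<omega>p (ball z0 sp - {z0})"
      using s_borel by (intro p.finite_measure_mono) (auto simp: s_def)
    moreover have "measure \<omega>n (ball z0 s - {z0}) \<le> measure \<omega>n (ball z0 sn - {z0})"
      using s_borel by (intro n.finite_measure_mono) (auto simp: s_def)
    ultimately show "m < 2 * e"
      using sp sn by (simp add: m_def)
    show "m \<ge> 0"
      by (simp add: m_def)
  qed
  define T where "T = measure \<omega>p UNIV + measure \<omega>n UNIV"
  \<comment> \<open>An upper bound for the coefficient of \<open>r\<close> in the rest of the
    estimate: \<open>4 * T / s\<close> for distant mass, using \<open>s - r \<ge> s / 2\<close>, and
    \<open>4 * pi * c\<close> for \<open>h\<close>. The summand 1 makes \<open>D\<close> positive,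
    so that it can be divided by.\<close>
  define D where "D = 4 * T / s + 4 * pi * c + 1"
  have T: "T \<ge> 0" by (simp add: T_def)
  have D: "D > 0"
    using T s c by (simp add: D_def add_nonneg_pos)
  \<comment> \<open>\<open>R / 2\<close> keeps the closed disc in \<open>M\<close> and the
    derivative of \<open>F\<close> bounded by \<open>c\<close>; \<open>s / 2\<close> separates the
    circle from the distant mass; the last bound makes \<open>\<rho> * D\<close> at most the other
    \<open>\<epsilon> / 2\<close>.\<close>
  define \<rho> where "\<rho> = min (min (R / 2) (s / 2)) (\<epsilon> / (2 * D))"
  define \<delta> where "\<delta> = \<rho> / (1 + \<eta>)"
  have \<rho>: "\<rho> > 0" "\<rho> \<le> R / 2" "\<rho> \<le> s / 2" "\<rho> \<le> \<epsilon> / (2 * D)"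
    using R s D \<open>\<epsilon> > 0\<close> by (auto simp: \<rho>_def)
  have \<delta>: "\<delta> > 0" "\<delta> * (1 + \<eta>) = \<rho>"
    using \<rho> \<open>\<eta> > 0\<close> by (auto simp: \<delta>_def)
  have \<delta>_less: "\<delta> < \<delta> * (1 + \<eta> / 2)"
    using \<delta> \<open>\<eta> > 0\<close> by (simp add: algebra_simps)
  have "countable ({r. emeasure \<omega>p (sphere z0 r) \<noteq> 0} \<union> {r. emeasure \<omega>n (sphere z0 r) \<noteq> 0})"
    by (intro countable_Un countable_charged_spheres fin)
  moreover have "uncountable {\<delta><..<\<delta> * (1 + \<eta> / 2)}"
    using \<delta>_less by (simp add: uncountable_open_interval)
  \<comment> \<open>A circle without mass keeps the kept and the swept parts mutually singular.\<close>
  ultimately have "\<not> {\<delta><..<\<delta> * (1 + \<eta> / 2)} \<subseteq>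
      {r. emeasure \<omega>p (sphere z0 r) \<noteq> 0} \<union> {r. emeasure \<omega>n (sphere z0 r) \<noteq> 0}"
    using countable_subset by blast
  then obtain r where r: "\<delta> < r" "r < \<delta> * (1 + \<eta> / 2)"
    and null: "emeasure \<omega>p (sphere z0 r) = 0" "emeasure \<omega>n (sphere z0 r) = 0"
    by auto
  have "\<delta> * (1 + \<eta> / 2) < \<rho>"
    using \<delta> \<open>\<eta> > 0\<close> by (simp add: algebra_simps flip: \<delta>(2))
  then have r': "0 < r" "r < \<rho>" "r < s"
    using r \<delta> \<rho> s by auto
  define g where "g = sweep_density \<omega>p \<omega>n z0 \<rho> F'"
  have g: "g \<in> borel_measurable borel"
    unfolding g_def by (rule sweep_density_measurable[OF fin F'_meas])
  have F'_bound: "cmod (F' w) \<le> c" if "w \<in> sphere z0 r" for w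
    using c(2)[of w] c(1) that r' \<rho> by (simp add: F'_def indicator_def)
  define b where "b = 2 * \<kappa> * m + r * (4 * T / s + 4 * pi * c)"
  have b: "b \<ge> 0"
    using \<kappa> m T s c r' by (simp add: b_def)
  have g_bound: "\<bar>g w\<bar> \<le> b" if "w \<in> sphere z0 r" for w
  proof -
    have "\<bar>g w\<bar> \<le> 2 * (r / (\<rho> - r)) * m + 2 * (r / (s - r)) * T + 4 * pi * r * c"
      unfolding g_def m_def T_def by (intro sweep_density_bound fin r' that F'_bound)
    moreover have "r / (\<rho> - r) \<le> \<kappa>"
    proof -
      have "r / (\<rho> - r) \<le> \<delta> * (1 + \<eta> / 2) / (\<delta> * (1 + \<eta>) - \<delta> * (1 + \<eta> / 2))"
        using r r' \<delta> \<open>\<eta> > 0\<close> by (intro frac_le) (auto simp: algebra_simps)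
      also have "\<delta> * (1 + \<eta>) - \<delta> * (1 + \<eta> / 2) = \<delta> * (\<eta> / 2)"
        by (simp add: algebra_simps)
      also have "\<delta> * (1 + \<eta> / 2) / (\<delta> * (\<eta> / 2)) = \<kappa>"
        using \<delta> \<open>\<eta> > 0\<close> by (simp add: \<kappa>_def field_simps)
      finally show ?thesis .
    qed
    then have "2 * (r / (\<rho> - r)) * m \<le> 2 * \<kappa> * m"
      using m by (intro mult_right_mono) auto
    moreover have "r / (s - r) \<le> r / (s / 2)"
      using r' \<rho> s by (intro divide_left_mono) auto
    then have "2 * (r / (s - r)) * T \<le> 2 * (r / (s / 2)) * T"
      using T by (intro mult_right_mono) auto
    ultimately show ?thesis
      by (simp add: b_def algebra_simps)
  qed
  define \<tau>p where "\<tau>p = localized z0 r \<rho> \<omega>p g"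
  define \<tau>n where "\<tau>n = localized z0 r \<rho> \<omega>n (\<lambda>w. - g w)"
  have off: "measure \<tau>p A = measure \<omega>p (ball z0 \<rho> \<inter> A)" "measure \<tau>n A = measure \<omega>n (ball z0 \<rho> \<inter> A)"
    if "A \<in> sets borel" "A \<inter> sphere z0 r = {}" for A
    unfolding \<tau>p_def \<tau>n_def using that r' g by (auto intro!: measure_localized_disjoint_sphere fin)
  have 1: "cball z0 \<rho> \<subseteq> M"
    using R \<rho> by (intro order_trans[OF _ R(2)]) auto
  have 2: "jordan_pair \<tau>p \<tau>n"
    unfolding \<tau>p_def \<tau>n_def using r' by (intro jordan_pair_localized[OF assms(5) _ g g_bound null]) auto
  have 3: "measure \<tau>p A - measure \<tau>n A = measure \<omega>p A - measure \<omega>n A"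
    if "A \<in> sets borel" "A \<subseteq> ball z0 \<delta>" for A
  proof -
    \<comment> \<open>Since \<open>\<delta> < r\<close>, the circle carrying the added mass misses
      the disc on which \<omega> must stay unchanged.\<close>
    have "A \<inter> sphere z0 r = {}" "ball z0 \<rho> \<inter> A = A"
      using that r r' by force+
    then show ?thesis
      using off[OF that(1)] by simp
  qed
  have 4: "measure \<tau>p A - measure \<tau>n A = 0" if "A \<in> sets borel" "A \<inter> ball z0 \<rho> = {}" for A
  proof -
    have "A \<inter> sphere z0 r = {}" "ball z0 \<rho> \<inter> A = {}"
      using that r' by force+
    then show ?thesis
      using off[OF that(1)] by simp
  qed
  have 5: "measure \<tau>p (ball z0 \<rho> - {z0}) + measure \<tau>n (ball z0 \<rho> - {z0}) < \<epsilon>"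
  proof -
    have "measure \<omega>p (ball z0 \<rho> \<inter> (ball z0 \<rho> - {z0})) \<le> measure \<omega>p (ball z0 s - {z0})"
      "measure \<omega>n (ball z0 \<rho> \<inter> (ball z0 \<rho> - {z0})) \<le> measure \<omega>n (ball z0 s - {z0})"
      using s_borel \<rho> s by (auto intro!: p.finite_measure_mono n.finite_measure_mono)
    moreover have "measure \<tau>p (ball z0 \<rho> - {z0}) + measure \<tau>n (ball z0 \<rho> - {z0}) \<le>
        measure \<omega>p (ball z0 \<rho> \<inter> (ball z0 \<rho> - {z0})) + measure \<omega>n (ball z0 \<rho> \<inter> (ball z0 \<rho> - {z0})) + b"
      unfolding \<tau>p_def \<tau>n_def using r' b by (intro measure_localized_le[OF fin _ g g_bound]) auto
    ultimately have "measure \<tau>p (ball z0 \<rho> - {z0}) + measure \<tau>n (ball z0 \<rho> - {z0}) \<le>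
        (1 + 2 * \<kappa>) * m + r * (4 * T / s + 4 * pi * c)"
      by (simp add: m_def b_def algebra_simps)
    moreover have "(1 + 2 * \<kappa>) * m < (1 + 2 * \<kappa>) * (2 * e)"
      using m \<kappa> by (intro mult_strict_left_mono) auto
    moreover have "(1 + 2 * \<kappa>) * (2 * e) = \<epsilon> / 2"
      using \<kappa> by (simp add: e_def field_simps)
    moreover have "r * (4 * T / s + 4 * pi * c) \<le> \<rho> * D"
      using r' T s c by (intro mult_mono) (auto simp: D_def)
    moreover have "\<rho> * D \<le> \<epsilon> / (2 * D) * D"
      using \<rho> D by (intro mult_right_mono) auto
    moreover have "\<epsilon> / (2 * D) * D = \<epsilon> / 2"
      using D by simp
    ultimately show ?thesis
      by linarith
  qed
  define k where "k = Re (F z0) + 1 / (2 * pi) *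
      ((\<integral>\<zeta>. indicator (- ball z0 \<rho>) \<zeta> * ln (cmod (z0 - \<zeta>)) \<partial>\<omega>p) -
       (\<integral>\<zeta>. indicator (- ball z0 \<rho>) \<zeta> * ln (cmod (z0 - \<zeta>)) \<partial>\<omega>n))"
  have 6: "pot_h \<omega>p \<omega>n h z = pot \<tau>p z - pot \<tau>n z + ereal k" if "z \<in> ball z0 \<delta>" for z
  proof -
    have z: "z \<in> ball z0 r" "z \<in> ball z0 R"
      using that r r' \<rho> by auto
    have F'\<rho>: "(F has_field_derivative F' w) (at w)" if "w \<in> ball z0 \<rho>" for w
      using that \<rho> by (intro F'_deriv) auto
    have "pot \<omega>p z - pot \<omega>n z + ereal (Re (F z)) = pot \<tau>p z - pot \<tau>n z + ereal k"
      unfolding \<tau>p_def \<tau>n_def g_def k_def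
      by (rule pot_localized_sweep_density[OF fin K F'\<rho> F'_meas F'_bound r'(1,2) z(1)])
    then show ?thesis
      by (simp add: pot_h_def hF[OF z(2)])
  qed
  show ?thesis
    using \<delta> 1 2 3 4 5 6 by (intro exI[of _ \<delta>] exI[of _ k] exI[of _ \<tau>p] exI[of _ \<tau>n]) simp
qed

end
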